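(* The number of $n$-point dominoes is $$\frac{2(3n+3)!}{(n+2)!\,(2n+3)!}.$$ Consequently, if $\mathcal D$ denotes the set of all dominoes, then its growth rate is $\mathrm{gr}(\mathcal D)=27/4$.
   Context: A permutation avoids a pattern $\pi$ if it has no subsequence order isomorphic to $\pi$. An $n$-point domino ($n\ge0$) is a two-cell gridded permutation, i.e. a pair $(\sigma,r)$ where $\sigma$ is a permutation of length $n$ avoiding $1324$ and $r\in\{1,\dots,n+1\}$ is a row divider, such that the subsequence of entries of $\sigma$ with value at least $r$ (the top cell) avoids $213$, and the subsequence of entries with value less than $r$ (the bottom cell) avoids $132$. Pairs with the same $\sigma$ but different $r$ are distinct dominoes. The growth rate of an infinite set $\mathcal A$ of combinatorial objects is $\mathrm{gr}(\mathcal A)=\limsup_{n\to\infty}|\mathcal A_n|^{1/n}$, where $\mathcal A_n$ is the set of elements of size $n$; the size of a domino is its number of points. *)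

theory Defs
  imports
    "HOL-Library.Sublist"
    "HOL-Library.Extended_Real"
    "HOL-Combinatorics.Multiset_Permutations"
begin

text \<open>A permutation of length \<open>n\<close> is written in one-line notation, as a list
  in \<open>permutations_of_set {1..n}\<close>. Order isomorphism and avoidance are defined for arbitrary
  lists of naturals, since the entries lying in one cell of a domino need not form an
  interval \<open>{1..k}\<close>.\<close>

definition order_isomorphic :: "nat list \<Rightarrow> nat list \<Rightarrow> bool" where
  "order_isomorphic xs ys \<longleftrightarrow>
     length xs = length ys \<and>
     (\<forall>i<length xs. \<forall>j<length xs. xs ! i < xs ! j \<longleftrightarrow> ys ! i < ys ! j)"

definition avoids :: "nat list \<Rightarrow> nat list \<Rightarrow> bool" where
  "avoids xs p \<longleftrightarrow> \<not> (\<exists>ys. subseq ys xs \<and> order_isomorphic ys p)"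

definition dominoes :: "(nat list \<times> nat) set" where
  "dominoes = {(\<sigma>, r).
     \<sigma> \<in> permutations_of_set {1..length \<sigma>} \<and>
     avoids \<sigma> [1, 3, 2, 4] \<and>
     r \<in> {1..length \<sigma> + 1} \<and>
     avoids (filter (\<lambda>v. v \<ge> r) \<sigma>) [2, 1, 3] \<and>
     avoids (filter (\<lambda>v. v < r) \<sigma>) [1, 3, 2]}"

definition domino_size :: "nat list \<times> nat \<Rightarrow> nat" where
  "domino_size d = length (fst d)"

definition of_size :: "('a \<Rightarrow> nat) \<Rightarrow> 'a set \<Rightarrow> nat \<Rightarrow> 'a set" where
  "of_size sz A n = {x \<in> A. sz x = n}"

text \<open>The limit superior is taken in the extended reals, where it always exists. The term at
  \<open>n = 0\<close>, where \<open>root 0 x = 0\<close>, does not affect it. The definition is meaningful only if there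
  are finitely many objects of each size, as \<open>card\<close> is 0 on infinite sets.\<close>

definition growth_rate :: "('a \<Rightarrow> nat) \<Rightarrow> 'a set \<Rightarrow> ereal" where
  "growth_rate sz A = limsup (\<lambda>n. ereal (root n (real (card (of_size sz A n)))))"

end

theory Submission
  imports Defs "HOL-Computational_Algebra.Formal_Power_Series" "HOL-Real_Asymp.Real_Asymp"
begin

text \<open>
  In a domino no occurrence of 1324 has three points in one cell: the points 1, 3, 2 below the
  divider would form a 132, and 3, 2, 4 above it a 213. So 1324 is avoided exactly when no bottom
  pair \<open>a < b\<close> and top pair \<open>c < d\<close> interleave in the order \<open>a\<close>, \<open>c\<close>, \<open>b\<close>, \<open>d\<close>. Subtracting
  the divider from every value turns a domino into a list of integers, negative in the bottom cell
  and nonnegative in the top cell (\<open>card_dominoes\<close>).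

  Count dominoes by their number of points and by the number \<open>i\<close> of places, besides the lowest
  one, where the value of a new last bottom point may go. Let \<open>D(t,u)\<close> be the generating function
  and \<open>Y(t,u)\<close> the part of it coming from dominoes that are empty or end in a top point.

  A bottom point at the end never completes an interleaving, since that pattern ends in the top
  cell. So its value only has to keep the bottom cell free of 132, and the \<open>i + 1\<close> choices
  lead to the statistics \<open>1, \<dots>, i + 1\<close>. A domino that ends in a top point splits at its lowest
  top point \<open>m\<close> as \<open>X m R\<close>, where \<open>R\<close> is empty or again ends in a top point. In both cells
  every point of \<open>X\<close> lies above every point of \<open>R\<close>, as otherwise \<open>m\<close> would complete a 213, or
  \<open>m\<close> and the last point an interleaving. So \<open>X\<close> and \<open>R\<close> are independent and their statistics
  add up. With \<open>v = u - 1\<close> this gives (\<open>domino_poly_Suc\<close>, \<open>top_ended_poly_Suc\<close>)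
  \[ v D = v Y + t u (u D - D(t,1)), \qquad Y = 1 + t D Y. \]

  As series in \<open>t\<close> over the power series in \<open>v\<close> these equations have only one solution
  (\<open>functional_equation_unique\<close>), so it suffices to exhibit one. Let \<open>z(1 - z)\<^sup>2 = t\<close>. Eliminating
  \<open>D\<close> leaves a quadratic equation for \<open>Y\<close>, and for \<open>D(t,1) = (1 - 2z) / (1 - z)\<^sup>4\<close> its
  discriminant has a square factor; the resulting \<open>Y\<close> is a power series and satisfies both equations
  (\<open>functional_equation_solution\<close>). Differentiating the formula for \<open>D(t,1)\<close> gives a
  first-order recurrence for the numbers of dominoes (\<open>coefficient_recurrence\<close>), which yields both
  the closed form and the growth rate.
\<close>

unbundle fps_syntax

section \<open>Short subsequences\<close>

lemma subseq_set: "subseq ys xs \<Longrightarrow> set ys \<subseteq> set xs"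
  by (auto simp: subseq_conv_nths dest: in_set_nthsD)

lemma subseq_filter_iff: "subseq ys (filter P xs) \<longleftrightarrow> subseq ys xs \<and> (\<forall>y\<in>set ys. P y)"
proof safe
  show "subseq ys xs" if "subseq ys (filter P xs)"
    using that subseq_filter_left subseq_order.order_trans by blast
  show "P y" if "subseq ys (filter P xs)" "y \<in> set ys" for y
    using subseq_set[OF that(1)] that(2) by auto
  show "subseq ys (filter P xs)" if "subseq ys xs" "\<forall>y\<in>set ys. P y"
    using subseq_filter[OF that(1), of P] that(2) by (simp add: filter_id_conv[THEN iffD2])
qed

lemma subseq_map_iff: "subseq ys (map f xs) \<longleftrightarrow> (\<exists>zs. ys = map f zs \<and> subseq zs xs)"
proof
  show "\<exists>zs. ys = map f zs \<and> subseq zs xs" if "subseq ys (map f xs)"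
    using that unfolding subseq_conv_nths by (metis nths_map)
qed (auto intro: subseq_map)

lemma subseq_map2:
  "subseq [a, b] (map f xs) \<longleftrightarrow> (\<exists>x y. a = f x \<and> b = f y \<and> subseq [x, y] xs)"
  unfolding subseq_map_iff Cons_eq_map_conv Nil_is_map_conv by simp blast

lemma subseq_map_all2:
  "(\<forall>a b. subseq [a, b] (map f xs) \<longrightarrow> P a b) \<longleftrightarrow>
   (\<forall>a b. subseq [a, b] xs \<longrightarrow> P (f a) (f b))"
  unfolding subseq_map2 by blast

lemma subseq_map_all3:
  "(\<forall>a b c. subseq [a, b, c] (map f xs) \<longrightarrow> P a b c) \<longleftrightarrow>
   (\<forall>a b c. subseq [a, b, c] xs \<longrightarrow> P (f a) (f b) (f c))"
proof -
  have "subseq [a, b, c] (map f xs) \<longleftrightarrow>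
      (\<exists>x y z. a = f x \<and> b = f y \<and> c = f z \<and> subseq [x, y, z] xs)" for a b c
    unfolding subseq_map_iff Cons_eq_map_conv Nil_is_map_conv by simp blast
  then show ?thesis by (simp only:) blast
qed

lemma subseq_map_all4:
  "(\<forall>a b c d. subseq [a, b, c, d] (map f xs) \<longrightarrow> P a b c d) \<longleftrightarrow>
   (\<forall>a b c d. subseq [a, b, c, d] xs \<longrightarrow> P (f a) (f b) (f c) (f d))"
proof -
  have "subseq [a, b, c, d] (map f xs) \<longleftrightarrow>
      (\<exists>x y z w. a = f x \<and> b = f y \<and> c = f z \<and> d = f w \<and> subseq [x, y, z, w] xs)" for a b c d
    unfolding subseq_map_iff Cons_eq_map_conv Nil_is_map_conv by simp blast
  then show ?thesis by (simp only:) blast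
qed

lemma ex_append_eq_Nil: "(\<exists>us vs. [] = us @ vs \<and> P us vs) \<longleftrightarrow> P [] []"
  by simp

lemma ex_append_eq_Cons:
  "(\<exists>us vs. a # as = us @ vs \<and> P us vs) \<longleftrightarrow> P [] (a # as) \<or> (\<exists>us vs. as = us @ vs \<and> P (a # us) vs)"
  by (auto simp: Cons_eq_append_conv)

lemma subseq2_append:
  "subseq [a, b] (xs @ ys) \<longleftrightarrow> subseq [a, b] xs \<or> (a \<in> set xs \<and> b \<in> set ys) \<or> subseq [a, b] ys"
  unfolding subseq_append_iff ex_append_eq_Cons ex_append_eq_Nil subseq_singleton_left
  by simp blast

lemma subseq3_append:
  "subseq [a, b, c] (xs @ ys) \<longleftrightarrow>
     subseq [a, b, c] xs \<or> (subseq [a, b] xs \<and> c \<in> set ys) \<or>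
     (a \<in> set xs \<and> subseq [b, c] ys) \<or> subseq [a, b, c] ys"
  unfolding subseq_append_iff ex_append_eq_Cons ex_append_eq_Nil subseq_singleton_left
  by simp blast

lemma subseq4_append:
  "subseq [a, b, c, d] (xs @ ys) \<longleftrightarrow>
     subseq [a, b, c, d] xs \<or> (subseq [a, b, c] xs \<and> d \<in> set ys) \<or>
     (subseq [a, b] xs \<and> subseq [c, d] ys) \<or> (a \<in> set xs \<and> subseq [b, c, d] ys) \<or>
     subseq [a, b, c, d] ys"
  unfolding subseq_append_iff ex_append_eq_Cons ex_append_eq_Nil subseq_singleton_left
  by simp blast

lemma subseq2_map_snoc_all:
  "(\<forall>x y. subseq [x, y] (map f xs @ [b]) \<longrightarrow> P x y) \<longleftrightarrow>
   (\<forall>x y. subseq [x, y] xs \<longrightarrow> P (f x) (f y)) \<and> (\<forall>x\<in>set xs. P (f x) b)"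
proof -
  have "subseq [x, y] (map f xs @ [b]) \<longleftrightarrow>
      (\<exists>x' y'. x = f x' \<and> y = f y' \<and> subseq [x', y'] xs) \<or> (\<exists>x'\<in>set xs. x = f x' \<and> y = b)" for x y
    unfolding subseq2_append subseq_map2 by auto
  then show ?thesis by (simp only:) blast
qed

section \<open>Dominoes as lists of signed integers\<close>

text \<open>A list of integers stands for a domino with divider at 0: its negative entries are the bottom
  points and its nonnegative entries the top points. The last condition forbids a bottom pair
  \<open>a < b\<close> to interleave with a top pair \<open>c < d\<close>. It replaces the avoidance of 1324, which
  involves comparisons between the two cells.\<close>

definition admissible :: "int list \<Rightarrow> bool" where
  "admissible xs \<longleftrightarrow>
     (\<forall>a b c. subseq [a, b, c] xs \<longrightarrow> \<not> (0 \<le> b \<and> b < a \<and> a < c) \<and> \<not> (a < c \<and> c < b \<and> b < 0)) \<and>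
     (\<forall>a c b d. subseq [a, c, b, d] xs \<longrightarrow> \<not> (a < b \<and> b < 0 \<and> 0 \<le> c \<and> c < d))"

definition cell_mono :: "int set \<Rightarrow> (int \<Rightarrow> int) \<Rightarrow> bool" where
  "cell_mono A f \<longleftrightarrow> (\<forall>x\<in>A. f x < 0 \<longleftrightarrow> x < 0) \<and>
     (\<forall>x\<in>A. \<forall>y\<in>A. (x < 0 \<longleftrightarrow> y < 0) \<longrightarrow> (f x < f y \<longleftrightarrow> x < y))"

text \<open>Every condition compares points of one cell only, so the two cells may be shifted
  independently.\<close>

lemma admissible_map:
  assumes "cell_mono (set xs) f"
  shows "admissible (map f xs) \<longleftrightarrow> admissible xs"
proof -
  have sgn: "f x < 0 \<longleftrightarrow> x < 0" if "x \<in> set xs" for x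
    using assms that by (auto simp: cell_mono_def)
  have ord: "f x < f y \<longleftrightarrow> x < y" if "x \<in> set xs" "y \<in> set xs" "x < 0 \<longleftrightarrow> y < 0" for x y
    using assms that by (auto simp: cell_mono_def)
  have "(\<not> (0 \<le> f b \<and> f b < f a \<and> f a < f c) \<and> \<not> (f a < f c \<and> f c < f b \<and> f b < 0)) \<longleftrightarrow>
        (\<not> (0 \<le> b \<and> b < a \<and> a < c) \<and> \<not> (a < c \<and> c < b \<and> b < 0))"
    if "subseq [a, b, c] xs" for a b c
    using subseq_set[OF that] sgn[of a] sgn[of b] sgn[of c] ord[of a c] ord[of c b] ord[of b a]
    by (auto simp: not_less)
  moreover have "(\<not> (f a < f b \<and> f b < 0 \<and> 0 \<le> f c \<and> f c < f d)) \<longleftrightarrow>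
        (\<not> (a < b \<and> b < 0 \<and> 0 \<le> c \<and> c < d))"
    if "subseq [a, c, b, d] xs" for a b c d
    using subseq_set[OF that] sgn[of a] sgn[of b] sgn[of c] sgn[of d] ord[of a b] ord[of c d]
    by (auto simp: not_less)
  ultimately show ?thesis
    unfolding admissible_def subseq_map_all3 subseq_map_all4 by meson
qed

definition bottoms :: "int list \<Rightarrow> nat" where
  "bottoms xs = length (filter (\<lambda>x. x < 0) xs)"

definition tops :: "int list \<Rightarrow> nat" where
  "tops xs = length (filter (\<lambda>x. 0 \<le> x) xs)"

text \<open>Among all lists with the same relative order in each cell, the one whose values are consecutive
  around 0.\<close>

definition normalized :: "int list \<Rightarrow> bool" where
  "normalized xs \<longleftrightarrow> distinct xs \<and> set xs = {- int (bottoms xs)..<int (tops xs)}"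

lemma normalizedI:
  assumes "distinct xs" "set xs = {- int k..<int m}"
  shows "normalized xs" "bottoms xs = k" "tops xs = m"
proof -
  have count: "length (filter P xs) = card {x \<in> {- int k..<int m}. P x}" for P
    using distinct_card[OF distinct_filter[OF assms(1), of P]] by (simp only: set_filter assms(2))
  have "{x \<in> {- int k..<int m}. x < 0} = {- int k..<0}" by auto
  then show k: "bottoms xs = k" unfolding bottoms_def count by simp
  have "{x \<in> {- int k..<int m}. 0 \<le> x} = {0..<int m}" by auto
  then show m: "tops xs = m" unfolding tops_def count by simp
  show "normalized xs" using assms k m by (simp add: normalized_def)
qed

lemma bottoms_tops_append [simp]:
  "bottoms (xs @ ys) = bottoms xs + bottoms ys" "tops (xs @ ys) = tops xs + tops ys"
  by (simp_all add: bottoms_def tops_def)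

lemma bottoms_tops_Cons [simp]:
  "bottoms (x # xs) = (if x < 0 then Suc (bottoms xs) else bottoms xs)"
  "tops (x # xs) = (if x < 0 then tops xs else Suc (tops xs))"
  by (simp_all add: bottoms_def tops_def)

lemma bottoms_tops_Nil [simp]: "bottoms [] = 0" "tops [] = 0"
  by (simp_all add: bottoms_def tops_def)

lemma bottoms_tops_length: "bottoms xs + tops xs = length xs"
  by (induction xs) auto

definition signed_dominoes :: "nat \<Rightarrow> int list set" where
  "signed_dominoes n = {xs. normalized xs \<and> admissible xs \<and> length xs = n}"

lemma finite_signed_dominoes [simp]: "finite (signed_dominoes n)"
proof (rule finite_subset)
  show "signed_dominoes n \<subseteq> {xs. set xs \<subseteq> {- int n..int n} \<and> length xs = n}"
  proof (clarsimp simp: signed_dominoes_def normalized_def)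
    fix xs :: "int list" and x :: int
    assume "- int (bottoms xs) \<le> x" "x < int (tops xs)"
    then show "- int (length xs) \<le> x \<and> x \<le> int (length xs)"
      using bottoms_tops_length[of xs] by linarith
  qed
  show "finite {xs. set xs \<subseteq> {- int n..int n} \<and> length xs = n}"
    by (rule finite_lists_length_eq) simp
qed

section \<open>Appending a bottom point\<close>

text \<open>The value \<open>b\<close> names the gap just above \<open>b\<close>; a new last bottom point may be placed there if it
  does not become the 2 of a 132. The gap below all bottom points is always open; leaving it out
  makes the statistic additive under \<open>join\<close> below.\<close>

definition sites :: "int list \<Rightarrow> int set" where
  "sites xs = {b \<in> {- int (bottoms xs)..-1}. \<forall>x y. subseq [x, y] xs \<longrightarrow> \<not> (x \<le> b \<and> b < y \<and> y < 0)}"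

text \<open>The new point takes the value \<open>b\<close>, and the points below the gap move down to make room.\<close>

definition insert_bottom :: "int list \<Rightarrow> int \<Rightarrow> int list" where
  "insert_bottom xs b = map (\<lambda>x. if x \<le> b then x - 1 else x) xs @ [b]"

text \<open>A bottom point at the end can only complete a 132: the 213 lies in the top cell, and the
  forbidden interleaving ends with a top point.\<close>

lemma admissible_snoc_bottom:
  assumes "x < 0"
  shows "admissible (xs @ [x]) \<longleftrightarrow>
    admissible xs \<and> (\<forall>a b. subseq [a, b] xs \<longrightarrow> \<not> (a < x \<and> x < b \<and> b < 0))"
  using assms unfolding admissible_def subseq3_append subseq4_append by simp (smt (verit))

lemma cell_mono_open_gap:
  assumes "b < 0"
  shows "cell_mono A (\<lambda>x. if x \<le> b then x - 1 else x)"
  using assms by (auto simp: cell_mono_def)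

lemma sites_bounds: "b \<in> insert (- int (bottoms xs) - 1) (sites xs) \<Longrightarrow> b < 0 \<and> - int (bottoms xs) - 1 \<le> b"
  by (auto simp: sites_def)

lemma sites_valid:
  assumes "normalized xs" "b \<in> insert (- int (bottoms xs) - 1) (sites xs)" "subseq [x, y] xs"
  shows "\<not> (x \<le> b \<and> b < y \<and> y < 0)"
  using assms subseq_set[OF assms(3)] by (auto simp: sites_def normalized_def)

text \<open>The new point blocks all gaps below it except the lowest one, because the smallest bottom point
  precedes it and together with it forms an ascent around each such gap. The gaps from \<open>b\<close> upwards
  keep their names and their status. So the \<open>k\<close>-th open gap from the top produces a list with
  \<open>k\<close> sites.\<close>

lemma insert_bottom_props:
  assumes xs: "xs \<in> signed_dominoes n" and b: "b \<in> insert (- int (bottoms xs) - 1) (sites xs)"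
  shows "insert_bottom xs b \<in> signed_dominoes (Suc n)"
    and "bottoms (insert_bottom xs b) = Suc (bottoms xs)"
    and "sites (insert_bottom xs b) = {s \<in> insert (- int (bottoms xs) - 1) (sites xs). b \<le> s}"
proof -
  let ?f = "\<lambda>x. if x \<le> b then x - 1 else x :: int"
  note bb = sites_bounds[OF b]
  have norm: "normalized xs" and adm: "admissible xs" and len: "length xs = n"
    using xs by (auto simp: signed_dominoes_def)
  have set: "set xs = {- int (bottoms xs)..<int (tops xs)}" and dist: "distinct xs"
    using norm by (auto simp: normalized_def)
  have "distinct (insert_bottom xs b)"
    using dist by (auto simp: insert_bottom_def distinct_map inj_on_def)
  moreover have "set (insert_bottom xs b) = {- int (Suc (bottoms xs))..<int (tops xs)}"
  proof -
    have "?f ` {- int (bottoms xs)..<int (tops xs)} = {- int (Suc (bottoms xs))..<int (tops xs)} - {b}"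
    proof (intro equalityI subsetI)
      fix y assume y: "y \<in> {- int (Suc (bottoms xs))..<int (tops xs)} - {b}"
      show "y \<in> ?f ` {- int (bottoms xs)..<int (tops xs)}"
        using y bb by (intro image_eqI[of _ _ "if y < b then y + 1 else y"]) auto
    qed (use bb in \<open>auto split: if_splits\<close>)
    then show ?thesis using bb set by (auto simp: insert_bottom_def)
  qed
  ultimately have norm': "normalized (insert_bottom xs b)"
    and bot': "bottoms (insert_bottom xs b) = Suc (bottoms xs)"
    using normalizedI by blast+
  then show "bottoms (insert_bottom xs b) = Suc (bottoms xs)" by simp
  have "admissible (insert_bottom xs b)"
    unfolding insert_bottom_def
    using bb adm sites_valid[OF norm b]
    by (subst admissible_snoc_bottom)
      (auto simp: subseq_map_all2 admissible_map[OF cell_mono_open_gap])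
  then show "insert_bottom xs b \<in> signed_dominoes (Suc n)"
    using norm' len by (simp add: signed_dominoes_def insert_bottom_def)
  have valid': "(\<forall>x y. subseq [x, y] (insert_bottom xs b) \<longrightarrow> \<not> (x \<le> s \<and> s < y \<and> y < 0)) \<longleftrightarrow>
      b \<le> s \<and> (\<forall>x y. subseq [x, y] xs \<longrightarrow> \<not> (x \<le> s \<and> s < y \<and> y < 0))"
    (is "?L \<longleftrightarrow> ?R")
    if s: "- int (bottoms xs) - 1 \<le> s" "s < 0" for s
  proof -
    have mapped: "?L \<longleftrightarrow> (\<forall>x y. subseq [x, y] xs \<longrightarrow> \<not> (?f x \<le> s \<and> s < ?f y \<and> ?f y < 0)) \<and>
        (\<forall>x\<in>set xs. \<not> (?f x \<le> s \<and> s < b \<and> b < 0))"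
      unfolding insert_bottom_def subseq2_map_snoc_all by simp
    show ?thesis
    proof (cases "b \<le> s")
      case True
      then have "(?f x \<le> s \<and> s < ?f y \<and> ?f y < 0) \<longleftrightarrow> (x \<le> s \<and> s < y \<and> y < 0)" for x y
        using bb by auto
      then show ?thesis using True unfolding mapped by auto
    next
      case False
      then have "- int (bottoms xs) \<in> set xs" "?f (- int (bottoms xs)) \<le> s"
        using s bb unfolding set by auto
      then have "\<not> ?L" using False bb unfolding mapped by (meson not_le)
      then show ?thesis using False by simp
    qed
  qed
  have low: "\<forall>x y. subseq [x, y] xs \<longrightarrow> \<not> (x \<le> - int (bottoms xs) - 1 \<and> - int (bottoms xs) - 1 < y \<and> y < 0)"
    using sites_valid[OF norm] by blast
  show "sites (insert_bottom xs b) = {s \<in> insert (- int (bottoms xs) - 1) (sites xs). b \<le> s}"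
  proof (rule set_eqI)
    fix s
    have "s \<in> sites (insert_bottom xs b) \<longleftrightarrow> - int (bottoms xs) - 1 \<le> s \<and> s < 0 \<and>
        (\<forall>x y. subseq [x, y] (insert_bottom xs b) \<longrightarrow> \<not> (x \<le> s \<and> s < y \<and> y < 0))"
      unfolding sites_def bot' by auto
    also have "\<dots> \<longleftrightarrow> - int (bottoms xs) - 1 \<le> s \<and> s < 0 \<and> b \<le> s \<and>
        (\<forall>x y. subseq [x, y] xs \<longrightarrow> \<not> (x \<le> s \<and> s < y \<and> y < 0))"
      using valid'[of s] by blast
    also have "\<dots> \<longleftrightarrow> s \<in> {s \<in> insert (- int (bottoms xs) - 1) (sites xs). b \<le> s}"
      using low by (cases "s = - int (bottoms xs) - 1") (auto simp: sites_def)
    finally show "s \<in> sites (insert_bottom xs b) \<longleftrightarrow> \<dots>" .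
  qed
qed

lemma insert_bottom_inj:
  assumes "insert_bottom xs b = insert_bottom ys c"
  shows "xs = ys \<and> b = c"
proof -
  have "b = c" using assms by (simp add: insert_bottom_def)
  moreover have "inj (\<lambda>x. if x \<le> b then x - 1 else x :: int)" by (auto simp: inj_def)
  ultimately show ?thesis
    using assms by (auto simp: insert_bottom_def dest: map_injective)
qed

text \<open>Removing the last point and closing the gap that it leaves inverts the insertion.\<close>

lemma insert_bottom_surj:
  assumes zs: "zs \<in> signed_dominoes (Suc n)" and "last zs < 0"
  obtains xs b where "xs \<in> signed_dominoes n" "b \<in> insert (- int (bottoms xs) - 1) (sites xs)"
    "zs = insert_bottom xs b"
proof -
  let ?f = "\<lambda>b x. if x \<le> b then x - 1 else x :: int"
  have "zs \<noteq> []" using zs by (auto simp: signed_dominoes_def)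
  then obtain ys b where zs_eq: "zs = ys @ [b]" using rev_exhaust by blast
  have b: "b < 0" using assms(2) zs_eq by simp
  define xs where "xs = map (\<lambda>x. if x < b then x + 1 else x) ys"
  have norm: "normalized zs" and adm: "admissible zs" and len: "length zs = Suc n"
    using zs by (auto simp: signed_dominoes_def)
  define k m where "k = bottoms ys" and "m = tops ys"
  have km: "bottoms zs = Suc k" "tops zs = m" using b by (simp_all add: zs_eq k_def m_def)
  have set: "set zs = {- int (Suc k)..<int m}" and dist: "distinct zs"
    using norm km by (auto simp: normalized_def)
  have b_range: "- int (Suc k) \<le> b" using set zs_eq by auto
  have set_ys: "set ys = {- int (Suc k)..<int m} - {b}"
    using set dist zs_eq by auto
  have "map (?f b) xs = map id ys"
    unfolding xs_def map_map by (rule map_cong) (use set_ys in auto)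
  then have ys: "ys = map (?f b) xs" by simp
  have "distinct xs"
    using dist set_ys by (auto simp: xs_def zs_eq distinct_map inj_on_def)
  moreover have "set xs = {- int k..<int m}"
  proof -
    have "(\<lambda>x. if x < b then x + 1 else x) ` ({- int (Suc k)..<int m} - {b}) = {- int k..<int m}"
    proof (intro equalityI subsetI)
      fix y assume "y \<in> {- int k..<int m}"
      then show "y \<in> (\<lambda>x. if x < b then x + 1 else x) ` ({- int (Suc k)..<int m} - {b})"
        by (intro image_eqI[of _ _ "?f b y"]) auto
    qed (use b b_range in \<open>auto split: if_splits\<close>)
    then show ?thesis by (simp add: xs_def set_ys)
  qed
  ultimately have norm': "normalized xs" and bot: "bottoms xs = k"
    using normalizedI by blast+
  have "admissible ys" and valid: "\<forall>x y. subseq [x, y] ys \<longrightarrow> \<not> (x < b \<and> b < y \<and> y < 0)"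
    using adm b by (simp_all add: zs_eq admissible_snoc_bottom)
  then have adm': "admissible xs"
    using admissible_map[OF cell_mono_open_gap[OF b]] ys by metis
  show thesis
  proof (rule that)
    show "xs \<in> signed_dominoes n"
      using norm' adm' len by (simp add: signed_dominoes_def zs_eq xs_def)
    show "zs = insert_bottom xs b" by (simp add: insert_bottom_def zs_eq ys)
    have "\<not> (x \<le> b \<and> b < y \<and> y < 0)" if "subseq [x, y] xs" for x y
      using valid[unfolded ys subseq_map_all2] that by fastforce
    then show "b \<in> insert (- int (bottoms xs) - 1) (sites xs)"
      using b b_range by (auto simp: sites_def bot)
  qed
qed

section \<open>Splitting at the lowest top point\<close>

lemma admissibleD3:
  assumes "admissible xs" "subseq [a, b, c] xs"
  shows "\<not> (0 \<le> b \<and> b < a \<and> a < c)" "\<not> (a < c \<and> c < b \<and> b < 0)"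
  using assms unfolding admissible_def by blast+

lemma admissibleD4:
  assumes "admissible xs" "subseq [a, c, b, d] xs"
  shows "\<not> (a < b \<and> b < 0 \<and> 0 \<le> c \<and> c < d)"
  using assms unfolding admissible_def by blast

lemma admissible_subseq:
  assumes "admissible xs" "subseq ys xs"
  shows "admissible ys"
  using assms subseq_order.order_trans[OF _ assms(2)] unfolding admissible_def by meson

lemma admissible_Nil [simp]: "admissible []"
  by (simp add: admissible_def)

text \<open>In each forbidden pattern, the first point of either cell is exceeded by a later point of that
  cell. Nothing in \<open>X\<close> is exceeded by a later point outside \<open>X\<close>, so a pattern that starts in \<open>X\<close>
  stays in \<open>X\<close>; and \<open>m\<close> is too low to be the first point of a 213.\<close>

lemma admissible_glue:
  assumes X: "admissible X" and R: "admissible R" and m: "0 \<le> m"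
    and above_m: "\<And>x. x \<in> set X \<union> set R \<Longrightarrow> 0 \<le> x \<Longrightarrow> m < x"
    and tops_above: "\<And>x y. x \<in> set X \<Longrightarrow> y \<in> set R \<Longrightarrow> 0 \<le> x \<Longrightarrow> 0 \<le> y \<Longrightarrow> y < x"
    and bottoms_above: "\<And>x y. x \<in> set X \<Longrightarrow> y \<in> set R \<Longrightarrow> x < 0 \<Longrightarrow> y < 0 \<Longrightarrow> y < x"
  shows "admissible (X @ m # R)"
  unfolding admissible_def
proof (intro conjI allI impI)
  fix a b c assume s: "subseq [a, b, c] (X @ m # R)"
  then have cases: "subseq [a, b, c] X \<or> subseq [a, b, c] R \<or>
      (a \<in> set X \<and> c \<in> set (m # R)) \<or> (a = m \<and> b \<in> set R)"
    unfolding subseq3_append using subseq_set[of "[b, c]" "m # R"] subseq_set[of "[b, c]" R]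
      subseq_set[of "[a, b]" X]
    by (auto split: if_splits)
  show "\<not> (0 \<le> b \<and> b < a \<and> a < c)"
    using cases admissibleD3(1)[OF X, of a b c] admissibleD3(1)[OF R, of a b c]
      m above_m[of a] above_m[of b] tops_above[of a c] by auto
  show "\<not> (a < c \<and> c < b \<and> b < 0)"
    using cases admissibleD3(2)[OF X, of a b c] admissibleD3(2)[OF R, of a b c]
      m bottoms_above[of a c] by auto
next
  fix a c b d assume s: "subseq [a, c, b, d] (X @ m # R)"
  then have cases: "subseq [a, c, b, d] X \<or> subseq [a, c, b, d] R \<or>
      (a \<in> set X \<and> b \<in> set (m # R)) \<or> (c \<in> set X \<and> d \<in> set (m # R)) \<or> a = m"
    unfolding subseq4_append using subseq_set[of "[c, b, d]" "m # R"] subseq_set[of "[b, d]" "m # R"]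
      subseq_set[of "[a, c, b]" X] subseq_set[of "[a, c]" X]
    by (auto split: if_splits)
  show "\<not> (a < b \<and> b < 0 \<and> 0 \<le> c \<and> c < d)"
    using cases admissibleD4[OF X, of a c b d] admissibleD4[OF R, of a c b d]
      m above_m[of c] bottoms_above[of a b] tops_above[of c d] by auto
qed

definition lift_tops :: "nat \<Rightarrow> int \<Rightarrow> int" where
  "lift_tops t x = (if 0 \<le> x then x + 1 + int t else x)"

definition sink_bottoms :: "nat \<Rightarrow> int \<Rightarrow> int" where
  "sink_bottoms b x = (if 0 \<le> x then x + 1 else x - int b)"

text \<open>The entry 0 becomes the lowest top point. The tops of \<open>X\<close> are lifted above 0 and the tops
  of \<open>R\<close>, and the bottoms of \<open>R\<close> are sunk below those of \<open>X\<close>.\<close>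

definition join :: "int list \<Rightarrow> int list \<Rightarrow> int list" where
  "join X R = map (lift_tops (tops R)) X @ 0 # map (sink_bottoms (bottoms X)) R"

lemma cell_mono_shifts: "cell_mono A (lift_tops t)" "cell_mono A (sink_bottoms b)"
  by (auto simp: cell_mono_def lift_tops_def sink_bottoms_def)

lemma inj_shifts: "inj (lift_tops t)" "inj (sink_bottoms b)"
  by (auto simp: inj_def lift_tops_def sink_bottoms_def split: if_splits)

lemma bottoms_tops_map [simp]:
  "bottoms (map (lift_tops t) xs) = bottoms xs" "tops (map (lift_tops t) xs) = tops xs"
  "bottoms (map (sink_bottoms b) xs) = bottoms xs" "tops (map (sink_bottoms b) xs) = tops xs"
  by (induction xs) (auto simp: lift_tops_def sink_bottoms_def)

lemma image_lift_tops:
  "lift_tops t ` {- int k..<int m} = {- int k..<0} \<union> {int t + 1..<int t + 1 + int m}"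
proof (intro equalityI subsetI)
  fix y assume "y \<in> {- int k..<0} \<union> {int t + 1..<int t + 1 + int m}"
  then show "y \<in> lift_tops t ` {- int k..<int m}"
    by (intro image_eqI[of _ _ "if 0 \<le> y then y - 1 - int t else y"]) (auto simp: lift_tops_def)
qed (auto simp: lift_tops_def split: if_splits)

lemma image_sink_bottoms:
  "sink_bottoms b ` {- int k..<int m} = {- int (b + k)..<- int b} \<union> {1..<1 + int m}"
proof (intro equalityI subsetI)
  fix y assume "y \<in> {- int (b + k)..<- int b} \<union> {1..<1 + int m}"
  then show "y \<in> sink_bottoms b ` {- int k..<int m}"
    by (intro image_eqI[of _ _ "if 0 \<le> y then y - 1 else y + int b"]) (auto simp: sink_bottoms_def)
qed (auto simp: sink_bottoms_def split: if_splits)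

text \<open>The empty list is included because nothing need follow the lowest top point.\<close>

definition top_ended :: "nat \<Rightarrow> int list set" where
  "top_ended n = {xs \<in> signed_dominoes n. xs = [] \<or> 0 \<le> last xs}"

lemma finite_top_ended [simp]: "finite (top_ended n)"
  by (rule finite_subset[OF _ finite_signed_dominoes[of n]]) (auto simp: top_ended_def)

text \<open>For the sites: a gap in the range of \<open>X\<close> has all bottom points of \<open>R\<close> below it, so only \<open>X\<close>
  can block it. A gap in the range of \<open>R\<close> has all bottom points of \<open>X\<close> above it, so only an
  ascent of \<open>R\<close> can straddle it. The lowest gap of \<open>X\<close> coincides with the highest gap of \<open>R\<close>.\<close>

lemma join_props:
  assumes X: "X \<in> signed_dominoes i" and R: "R \<in> signed_dominoes j"
  shows "join X R \<in> signed_dominoes (Suc (i + j))"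
    and "sites (join X R) = sites X \<union> (\<lambda>s. s - int (bottoms X)) ` sites R"
proof -
  let ?X = "map (lift_tops (tops R)) X" and ?R = "map (sink_bottoms (bottoms X)) R"
  have setX: "set X = {- int (bottoms X)..<int (tops X)}" and setR: "set R = {- int (bottoms R)..<int (tops R)}"
    and "distinct X" "distinct R"
    and adm: "admissible X" "admissible R" and len: "length X = i" "length R = j"
    using X R by (auto simp: signed_dominoes_def normalized_def)
  have set'X: "set ?X = {- int (bottoms X)..<0} \<union> {int (tops R) + 1..<int (tops R) + 1 + int (tops X)}"
    unfolding set_map setX image_lift_tops ..
  have set'R: "set ?R = {- int (bottoms X + bottoms R)..<- int (bottoms X)} \<union> {1..<1 + int (tops R)}"
    unfolding set_map setR image_sink_bottoms ..
  have "distinct (join X R)"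
    using \<open>distinct X\<close> \<open>distinct R\<close> set'X set'R
      inj_on_subset[OF inj_shifts(1) subset_UNIV] inj_on_subset[OF inj_shifts(2) subset_UNIV]
    unfolding join_def distinct_append distinct.simps distinct_map list.set by auto
  moreover have "set (join X R) = {- int (bottoms X + bottoms R)..<int (tops X + tops R + 1)}"
    unfolding join_def set_append list.set set'X set'R by auto
  ultimately have norm: "normalized (join X R)" and bot: "bottoms (join X R) = bottoms X + bottoms R"
    using normalizedI by blast+
  have "admissible (join X R)"
    unfolding join_def
    by (rule admissible_glue)
      (use adm set'X set'R in \<open>auto simp: admissible_map[OF cell_mono_shifts(1)] admissible_map[OF cell_mono_shifts(2)]\<close>)
  then show "join X R \<in> signed_dominoes (Suc (i + j))"
    using norm len by (simp add: signed_dominoes_def join_def)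
  have valid: "(\<forall>x y. subseq [x, y] (join X R) \<longrightarrow> \<not> (x \<le> s \<and> s < y \<and> y < 0)) \<longleftrightarrow>
      (\<forall>x y. subseq [x, y] X \<longrightarrow> \<not> (lift_tops (tops R) x \<le> s \<and> s < lift_tops (tops R) y \<and> lift_tops (tops R) y < 0)) \<and>
      (\<forall>x y. subseq [x, y] R \<longrightarrow> \<not> (sink_bottoms (bottoms X) x \<le> s \<and> s < sink_bottoms (bottoms X) y \<and> sink_bottoms (bottoms X) y < 0))"
    if s: "s < 0" for s
  proof -
    have "(\<forall>x y. subseq [x, y] (join X R) \<longrightarrow> \<not> (x \<le> s \<and> s < y \<and> y < 0)) \<longleftrightarrow>
        (\<forall>x y. subseq [x, y] ?X \<longrightarrow> \<not> (x \<le> s \<and> s < y \<and> y < 0)) \<and>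
        (\<forall>x y. subseq [x, y] ?R \<longrightarrow> \<not> (x \<le> s \<and> s < y \<and> y < 0))"
    proof -
      have "\<not> (x \<le> s \<and> s < y \<and> y < 0)" if "x \<in> set ?X" "y \<in> set (0 # ?R)" for x y
        using that s unfolding list.set set'X set'R by auto
      moreover have "subseq [x, y] (join X R) \<longleftrightarrow> subseq [x, y] ?X \<or> (x \<in> set ?X \<and> y \<in> set (0 # ?R)) \<or>
          subseq [x, y] ?R \<or> (x = 0 \<and> y \<in> set ?R)" for x y
        unfolding join_def subseq2_append[of x y ?X]
        using subseq2_append[of x y "[0]" ?R] by auto
      ultimately show ?thesis using s by (simp only:) (meson not_le)
    qed
    then show ?thesis unfolding subseq_map_all2 .
  qed
  show "sites (join X R) = sites X \<union> (\<lambda>s. s - int (bottoms X)) ` sites R" (is "_ = ?S")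
  proof (rule set_eqI)
    fix s
    have X_range: "- int (bottoms X) \<le> x" if "subseq [x, y] X" for x y
      using subseq_set[OF that] setX by auto
    have in_S: "s \<in> ?S \<longleftrightarrow> s \<in> sites X \<or> s + int (bottoms X) \<in> sites R"
      by force
    consider "0 \<le> s" | "- int (bottoms X) \<le> s" "s < 0" | "s < - int (bottoms X)" by linarith
    then show "s \<in> sites (join X R) \<longleftrightarrow> s \<in> ?S"
    proof cases
      case 1
      then show ?thesis unfolding in_S by (auto simp: sites_def)
    next
      case 2
      have "(sink_bottoms (bottoms X) x \<le> s \<and> s < sink_bottoms (bottoms X) y \<and> sink_bottoms (bottoms X) y < 0) \<longleftrightarrow> False"
        "(lift_tops (tops R) x \<le> s \<and> s < lift_tops (tops R) y \<and> lift_tops (tops R) y < 0) \<longleftrightarrow> (x \<le> s \<and> s < y \<and> y < 0)" for x y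
        using 2 by (auto simp: lift_tops_def sink_bottoms_def)
      then show ?thesis
        using 2 valid[of s] unfolding in_S unfolding sites_def bot by auto
    next
      case 3
      have "\<not> lift_tops (tops R) x \<le> s" if "subseq [x, y] X" for x y
        using 3 X_range[OF that] by (auto simp: lift_tops_def)
      moreover have "(sink_bottoms (bottoms X) x \<le> s \<and> s < sink_bottoms (bottoms X) y \<and> sink_bottoms (bottoms X) y < 0) \<longleftrightarrow>
          (x \<le> s + int (bottoms X) \<and> s + int (bottoms X) < y \<and> y < 0)" for x y
        using 3 by (auto simp: sink_bottoms_def)
      ultimately have "(\<forall>x y. subseq [x, y] (join X R) \<longrightarrow> \<not> (x \<le> s \<and> s < y \<and> y < 0)) \<longleftrightarrow>
          (\<forall>x y. subseq [x, y] R \<longrightarrow> \<not> (x \<le> s + int (bottoms X) \<and> s + int (bottoms X) < y \<and> y < 0))"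
        using 3 valid[of s] by (smt (verit) of_nat_0_le_iff)
      then show ?thesis
        using 3 unfolding in_S unfolding sites_def bot by auto
    qed
  qed
qed

lemma finite_sites [simp]: "finite (sites xs)"
  by (rule finite_subset[of _ "{- int (bottoms xs)..-1}"]) (auto simp: sites_def)

lemma card_sites_join:
  assumes "X \<in> signed_dominoes i" "R \<in> signed_dominoes j"
  shows "card (sites (join X R)) = card (sites X) + card (sites R)"
proof -
  have "sites X \<inter> (\<lambda>s. s - int (bottoms X)) ` sites R = {}"
    by (auto simp: sites_def)
  then show ?thesis
    unfolding join_props(2)[OF assms] by (simp add: card_Un_disjoint card_image inj_on_def)
qed

lemma join_inj:
  assumes "join X R = join X' R'"
  shows "X = X' \<and> R = R'"
proof -
  have "0 \<notin> set (map (lift_tops t) xs)" "0 \<notin> set (map (sink_bottoms b) xs)" for t b xs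
    by (auto simp: lift_tops_def sink_bottoms_def)
  then have maps: "map (lift_tops (tops R)) X = map (lift_tops (tops R')) X'"
    "map (sink_bottoms (bottoms X)) R = map (sink_bottoms (bottoms X')) R'"
    using assms unfolding join_def by (simp_all add: append_Cons_eq_iff)
  have "tops R = tops R'" using arg_cong[OF maps(2), of tops] by simp
  moreover have "bottoms X = bottoms X'" using arg_cong[OF maps(1), of bottoms] by simp
  ultimately show ?thesis
    using maps inj_shifts by (metis map_injective)
qed

lemma down_closed_int:
  fixes T :: "int set"
  assumes "finite T" "\<And>x. x \<in> T \<Longrightarrow> l \<le> x" "\<And>x y. x \<in> T \<Longrightarrow> l \<le> y \<Longrightarrow> y < x \<Longrightarrow> y \<in> T"
  shows "T = {l..<l + int (card T)}"
proof (cases "T = {}")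
  case False
  have T: "T = {l..Max T}"
  proof (intro equalityI subsetI)
    show "x \<in> {l..Max T}" if "x \<in> T" for x using that assms(1,2) by simp
    show "x \<in> T" if "x \<in> {l..Max T}" for x
      using that assms(3)[of "Max T" x] Max_in[OF assms(1) False] by (cases "x = Max T") auto
  qed
  have "l \<le> Max T" using assms(2) Max_in[OF assms(1) False] by blast
  then have "int (card T) = Max T + 1 - l" by (subst T) simp
  then show ?thesis by (subst T) auto
qed simp

text \<open>A top point \<open>x\<close> before the lowest top 0 exceeds every top point \<open>y\<close> after it, since otherwise
  \<open>x, 0, y\<close> is a 213. A bottom point \<open>x\<close> before 0 exceeds every bottom point \<open>y\<close> after it, since
  otherwise \<open>x, 0, y\<close> and the last point interleave; here it matters that the last point is a top.
  Hence the values in each part are consecutive within each cell, and they are known from the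
  numbers of points alone.\<close>

lemma join_surj:
  assumes zs: "zs \<in> top_ended (Suc n)"
  obtains i X R where "i \<le> n" "X \<in> signed_dominoes i" "R \<in> top_ended (n - i)" "zs = join X R"
proof -
  have norm: "normalized zs" and adm: "admissible zs" and len: "length zs = Suc n" and last: "0 \<le> last zs"
    using zs by (auto simp: top_ended_def signed_dominoes_def)
  have set: "set zs = {- int (bottoms zs)..<int (tops zs)}" and dist: "distinct zs"
    using norm by (auto simp: normalized_def)
  have "zs \<noteq> []" using len by auto
  then have "0 \<in> set zs" using last set last_in_set[of zs] by auto
  then obtain A B where zs_eq: "zs = A @ 0 # B" using split_list by fastforce
  have adm': "admissible A" "admissible B"
    using adm by (auto simp: zs_eq intro: admissible_subseq)
  have tops_above: "y < x" if "x \<in> set A" "y \<in> set B" "0 \<le> x" "0 \<le> y" for x y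
  proof -
    have "subseq [x, 0, y] zs"
      using that unfolding zs_eq subseq3_append by (simp add: subseq_singleton_left)
    moreover have "x \<noteq> 0" "x \<noteq> y" using that dist by (auto simp: zs_eq)
    ultimately show ?thesis using admissibleD3(1)[OF adm] that by fastforce
  qed
  have bottoms_above: "y < x" if "x \<in> set A" "y \<in> set B" "x < 0" "y < 0" for x y
  proof -
    have "B \<noteq> []" using that by auto
    then obtain B' d where B: "B = B' @ [d]" using rev_exhaust by blast
    have d: "0 < d" using last dist by (auto simp: zs_eq B less_le)
    then have "y \<in> set B'" using that B by auto
    then have "subseq [y, d] B" unfolding B subseq2_append by simp
    then have "subseq [x, 0, y, d] zs"
      using that unfolding zs_eq subseq4_append by simp
    moreover have "x \<noteq> y" using that dist by (auto simp: zs_eq)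
    ultimately show ?thesis using admissibleD4[OF adm] that d by fastforce
  qed
  have bots: "bottoms zs = bottoms A + bottoms B" and tps: "tops zs = tops A + tops B + 1"
    by (simp_all add: zs_eq)
  have split: "x \<in> set A \<or> x = 0 \<or> x \<in> set B \<longleftrightarrow> - int (bottoms zs) \<le> x \<and> x < int (tops zs)" for x
  proof -
    have "x \<in> set zs \<longleftrightarrow> x \<in> set A \<or> x = 0 \<or> x \<in> set B" by (auto simp: zs_eq)
    then show ?thesis unfolding set by simp
  qed
  have disj: "set A \<inter> set B = {}" "0 \<notin> set A" "0 \<notin> set B" "distinct A" "distinct B"
    using dist by (auto simp: zs_eq)
  have card_bottoms: "card {x \<in> set B. x < 0} = bottoms B"
    unfolding bottoms_def using distinct_card[OF distinct_filter[OF disj(5), of "\<lambda>x. x < 0"]] by (simp only: set_filter)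
  have card_tops: "card {x \<in> set B. 0 \<le> x} = tops B"
    unfolding tops_def using distinct_card[OF distinct_filter[OF disj(5), of "\<lambda>x. 0 \<le> x"]] by (simp only: set_filter)
  have bottoms_B: "{x \<in> set B. x < 0} = {- int (bottoms zs)..<- int (bottoms A)}"
  proof -
    have "{x \<in> set B. x < 0} = {- int (bottoms zs)..<- int (bottoms zs) + int (card {x \<in> set B. x < 0})}"
    proof (rule down_closed_int)
      show "y \<in> {x \<in> set B. x < 0}"
        if "x \<in> {x \<in> set B. x < 0}" "- int (bottoms zs) \<le> y" "y < x" for x y
        using that split[of y] split[of x] bottoms_above[of y x] by auto
    qed (use split in auto)
    then show ?thesis unfolding card_bottoms by (simp add: bots)
  qed
  have tops_B: "{x \<in> set B. 0 \<le> x} = {1..<1 + int (tops B)}"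
  proof -
    have "{x \<in> set B. 0 \<le> x} = {1..<1 + int (card {x \<in> set B. 0 \<le> x})}"
    proof (rule down_closed_int)
      show "1 \<le> x" if "x \<in> {x \<in> set B. 0 \<le> x}" for x
        using that disj(3) by (cases "x = 0") auto
      show "y \<in> {x \<in> set B. 0 \<le> x}"
        if "x \<in> {x \<in> set B. 0 \<le> x}" "1 \<le> y" "y < x" for x y
        using that split[of y] split[of x] tops_above[of y x] by auto
    qed simp
    then show ?thesis unfolding card_tops .
  qed
  have mem_B: "x \<in> set B \<longleftrightarrow> (- int (bottoms zs) \<le> x \<and> x < - int (bottoms A)) \<or> (1 \<le> x \<and> x < 1 + int (tops B))" for x
  proof -
    have "x \<in> set B \<longleftrightarrow> x \<in> {x \<in> set B. x < 0} \<or> x \<in> {x \<in> set B. 0 \<le> x}" by auto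
    then show ?thesis unfolding bottoms_B tops_B by simp
  qed
  have mem_A: "x \<in> set A \<longleftrightarrow> (- int (bottoms A) \<le> x \<and> x < 0) \<or> (1 + int (tops B) \<le> x \<and> x < int (tops zs))" for x
  proof -
    have "x \<in> set A \<longleftrightarrow> (- int (bottoms zs) \<le> x \<and> x < int (tops zs)) \<and> x \<noteq> 0 \<and> x \<notin> set B"
    proof -
      have "x \<in> set A \<Longrightarrow> x \<noteq> 0 \<and> x \<notin> set B" using disj(1,2) by auto
      then show ?thesis using split[of x] by blast
    qed
    then show ?thesis unfolding mem_B bots tps of_nat_add of_nat_1 by linarith
  qed
  define X where "X = map (\<lambda>x. if 0 \<le> x then x - 1 - int (tops B) else x) A"
  define R where "R = map (\<lambda>x. if 0 \<le> x then x - 1 else x + int (bottoms A)) B"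
  have "map (lift_tops (tops B)) X = map id A"
    unfolding X_def map_map by (rule map_cong) (auto simp: mem_A lift_tops_def)
  then have A: "A = map (lift_tops (tops B)) X" by simp
  have "map (sink_bottoms (bottoms A)) R = map id B"
    unfolding R_def map_map by (rule map_cong) (auto simp: mem_B sink_bottoms_def)
  then have B: "B = map (sink_bottoms (bottoms A)) R" by simp
  have bt: "bottoms X = bottoms A" "tops X = tops A" "bottoms R = bottoms B" "tops R = tops B"
    by (subst A B, simp)+
  have "zs = join X R" unfolding join_def bt zs_eq using A B by simp
  have "distinct X" "distinct R"
    using disj(4,5) A B by (metis distinct_map)+
  moreover have "set X = {- int (bottoms A)..<int (tops A)}"
  proof -
    have "lift_tops (tops B) ` set X = lift_tops (tops B) ` {- int (bottoms A)..<int (tops A)}"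
      unfolding image_lift_tops set_map[symmetric] A[symmetric]
      by (rule set_eqI) (unfold Un_iff atLeastLessThan_iff mem_A tps of_nat_add of_nat_1, linarith)
    then show ?thesis using inj_image_eq_iff[OF inj_shifts(1)] by blast
  qed
  moreover have "set R = {- int (bottoms B)..<int (tops B)}"
  proof -
    have "sink_bottoms (bottoms A) ` set R = sink_bottoms (bottoms A) ` {- int (bottoms B)..<int (tops B)}"
      unfolding image_sink_bottoms set_map[symmetric] B[symmetric]
      by (rule set_eqI) (unfold Un_iff atLeastLessThan_iff mem_B bots of_nat_add, linarith)
    then show ?thesis using inj_image_eq_iff[OF inj_shifts(2)] by blast
  qed
  ultimately have norms: "normalized X" "normalized R" using normalizedI by blast+
  have adms: "admissible X" "admissible R"
    using adm' A B admissible_map[OF cell_mono_shifts(1)] admissible_map[OF cell_mono_shifts(2)] by metis+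
  have "R = [] \<or> 0 \<le> last R"
  proof (cases "B = []")
    case False
    then have "0 \<le> last B" using last by (simp add: zs_eq)
    moreover have "last B \<noteq> 0" using False disj(3) last_in_set by metis
    ultimately show ?thesis using False by (simp add: R_def last_map)
  qed (simp add: R_def)
  moreover have "length X + length R = n"
    using len by (simp add: X_def R_def zs_eq)
  ultimately show thesis
    using that[of "length X" X R] \<open>zs = join X R\<close> norms adms
    by (auto simp: signed_dominoes_def top_ended_def)
qed

section \<open>Generating polynomials\<close>

text \<open>With \<open>1 + v\<close> in place of the catalytic variable \<open>u\<close>, setting \<open>u = 1\<close> means taking the
  constant coefficient, and the quotient by \<open>u - 1\<close> becomes a quotient by \<open>v\<close>.\<close>

definition site_weight :: "int list \<Rightarrow> real fps" where
  "site_weight xs = (1 + fps_X) ^ card (sites xs)"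

definition domino_poly :: "nat \<Rightarrow> real fps" where
  "domino_poly n = (\<Sum>xs\<in>signed_dominoes n. site_weight xs)"

definition top_ended_poly :: "nat \<Rightarrow> real fps" where
  "top_ended_poly n = (\<Sum>xs\<in>top_ended n. site_weight xs)"

lemma domino_poly_nth_0: "domino_poly n $ 0 = real (card (signed_dominoes n))"
  by (simp add: domino_poly_def site_weight_def fps_sum_nth fps_power_zeroth)

lemma signed_dominoes_0: "signed_dominoes 0 = {[]}"
  by (auto simp: signed_dominoes_def normalized_def)

lemma top_ended_0: "top_ended 0 = {[]}"
  by (auto simp: top_ended_def signed_dominoes_0)

lemma polys_0: "domino_poly 0 = 1" "top_ended_poly 0 = 1"
proof -
  have "sites [] = {}" by (simp add: sites_def)
  then show "domino_poly 0 = 1" "top_ended_poly 0 = 1"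
    by (simp_all add: domino_poly_def top_ended_poly_def signed_dominoes_0 top_ended_0 site_weight_def)
qed

lemma top_ended_poly_Suc:
  "top_ended_poly (Suc n) = (\<Sum>i\<le>n. domino_poly i * top_ended_poly (n - i))"
proof -
  let ?P = "SIGMA i:{..n}. signed_dominoes i \<times> top_ended (n - i)"
  have te: "R \<in> signed_dominoes j" if "R \<in> top_ended j" for R j
    using that by (simp add: top_ended_def)
  have "bij_betw (\<lambda>(i, X, R). join X R) ?P (top_ended (Suc n))"
    unfolding bij_betw_def
  proof
    show "inj_on (\<lambda>(i, X, R). join X R) ?P"
      by (auto simp: inj_on_def signed_dominoes_def dest!: join_inj)
    show "(\<lambda>(i, X, R). join X R) ` ?P = top_ended (Suc n)"
    proof (intro equalityI subsetI)
      fix zs assume "zs \<in> (\<lambda>(i, X, R). join X R) ` ?P"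
      then obtain i X R where *: "i \<le> n" "X \<in> signed_dominoes i" "R \<in> top_ended (n - i)" "zs = join X R"
        by auto
      then have "zs \<in> signed_dominoes (Suc n)" using join_props(1)[OF *(2) te[OF *(3)]] by simp
      moreover have "0 \<le> last (join X R)"
      proof (cases "R = []")
        case False
        then have "0 \<le> last R" using *(3) by (simp add: top_ended_def)
        then show ?thesis using False by (simp add: join_def last_map sink_bottoms_def)
      qed (simp add: join_def)
      ultimately show "zs \<in> top_ended (Suc n)" by (simp add: top_ended_def *(4))
    next
      fix zs assume "zs \<in> top_ended (Suc n)"
      then obtain i X R where "i \<le> n" "X \<in> signed_dominoes i" "R \<in> top_ended (n - i)" "zs = join X R"
        by (rule join_surj)
      then show "zs \<in> (\<lambda>(i, X, R). join X R) ` ?P"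
        by (intro image_eqI[of _ _ "(i, X, R)"]) simp_all
    qed
  qed
  then have "top_ended_poly (Suc n) = (\<Sum>(i, X, R)\<in>?P. site_weight (join X R))"
    unfolding top_ended_poly_def
    by (subst sum.reindex_bij_betw[symmetric]) (auto simp: case_prod_unfold)
  also have "\<dots> = (\<Sum>i\<le>n. \<Sum>(X, R)\<in>signed_dominoes i \<times> top_ended (n - i). site_weight X * site_weight R)"
    by (subst sum.Sigma)
      (auto simp: site_weight_def card_sites_join[OF _ te] power_add intro!: sum.cong)
  also have "\<dots> = (\<Sum>i\<le>n. domino_poly i * top_ended_poly (n - i))"
    by (simp add: domino_poly_def top_ended_poly_def sum_product sum.cartesian_product)
  finally show ?thesis .
qed

text \<open>The exponents run through \<open>1, \<dots>, card S\<close> once each, so this is a geometric sum.\<close>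

lemma sum_power_card_above:
  fixes S :: "'a::linorder set" and q :: "'b::comm_ring_1"
  assumes "finite S"
  shows "q * (\<Sum>b\<in>S. (1 + q) ^ card {s \<in> S. b \<le> s}) = (1 + q) * ((1 + q) ^ card S - 1)"
  using assms
proof (induction S rule: finite_linorder_min_induct)
  case (insert a S)
  have "{s \<in> insert a S. b \<le> s} = {s \<in> S. b \<le> s}" if "b \<in> S" for b
    using insert.hyps(2) that by force
  then have "(\<Sum>b\<in>S. (1 + q) ^ card {s \<in> insert a S. b \<le> s}) = (\<Sum>b\<in>S. (1 + q) ^ card {s \<in> S. b \<le> s})"
    by (intro sum.cong) auto
  moreover have "{s \<in> insert a S. a \<le> s} = insert a S"
    using insert.hyps(2) by force
  moreover have "a \<notin> S" using insert.hyps(2) by blast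
  ultimately have "q * (\<Sum>b\<in>insert a S. (1 + q) ^ card {s \<in> insert a S. b \<le> s})
      = q * (1 + q) ^ Suc (card S) + (1 + q) * ((1 + q) ^ card S - 1)"
    using insert by (simp add: distrib_left)
  also have "\<dots> = (1 + q) * ((1 + q) ^ card (insert a S) - 1)"
    using insert.hyps(1) \<open>a \<notin> S\<close> by (simp add: algebra_simps)
  finally show ?case .
qed simp

text \<open>The second summand comes from appending a bottom point: a list of weight \<open>u\<^sup>i\<close> contributes
  \<open>u + \<dots> + u\<^sup>i\<^sup>+\<^sup>1\<close>, whose multiple by \<open>u - 1\<close> is \<open>u (u u\<^sup>i - 1)\<close>.\<close>

lemma domino_poly_Suc:
  "fps_X * domino_poly (Suc n) = fps_X * top_ended_poly (Suc n)
     + (1 + fps_X) * ((1 + fps_X) * domino_poly n - fps_const (domino_poly n $ 0))"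
proof -
  let ?B = "{xs \<in> signed_dominoes (Suc n). last xs < 0}"
  let ?S = "\<lambda>xs. insert (- int (bottoms xs) - 1) (sites xs)"
  let ?P = "SIGMA xs:signed_dominoes n. ?S xs"
  have "bij_betw (\<lambda>(xs, b). insert_bottom xs b) ?P ?B"
    unfolding bij_betw_def
  proof
    show "inj_on (\<lambda>(xs, b). insert_bottom xs b) ?P"
      by (auto simp: inj_on_def dest!: insert_bottom_inj)
    show "(\<lambda>(xs, b). insert_bottom xs b) ` ?P = ?B"
    proof (intro equalityI subsetI)
      fix zs assume "zs \<in> (\<lambda>(xs, b). insert_bottom xs b) ` ?P"
      then obtain xs b where *: "xs \<in> signed_dominoes n" "b \<in> ?S xs" "zs = insert_bottom xs b"
        by auto
      then show "zs \<in> ?B"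
        using insert_bottom_props(1)[OF *(1,2)] sites_bounds[OF *(2)] by (simp add: insert_bottom_def)
    next
      fix zs assume "zs \<in> ?B"
      then have "zs \<in> signed_dominoes (Suc n)" "last zs < 0" by auto
      then obtain xs b where "xs \<in> signed_dominoes n" "b \<in> ?S xs" "zs = insert_bottom xs b"
        by (rule insert_bottom_surj)
      then show "zs \<in> (\<lambda>(xs, b). insert_bottom xs b) ` ?P"
        by (intro image_eqI[of _ _ "(xs, b)"] SigmaI) simp_all
    qed
  qed
  then have "(\<Sum>zs\<in>?B. site_weight zs) = (\<Sum>(xs, b)\<in>?P. site_weight (insert_bottom xs b))"
    by (subst sum.reindex_bij_betw[symmetric]) (auto simp: case_prod_unfold)
  also have "\<dots> = (\<Sum>xs\<in>signed_dominoes n. \<Sum>b\<in>?S xs. (1 + fps_X) ^ card {s \<in> ?S xs. b \<le> s})"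
    by (subst sum.Sigma) (auto simp: site_weight_def insert_bottom_props(3) intro!: sum.cong)
  finally have "fps_X * (\<Sum>zs\<in>?B. site_weight zs) =
      (\<Sum>xs\<in>signed_dominoes n. fps_X * (\<Sum>b\<in>?S xs. (1 + fps_X) ^ card {s \<in> ?S xs. b \<le> s}))"
    by (simp only: sum_distrib_left[where A = "signed_dominoes n"])
  also have "\<dots> = (\<Sum>xs\<in>signed_dominoes n. (1 + fps_X) * ((1 + fps_X) ^ card (?S xs) - 1))"
    by (intro sum.cong refl sum_power_card_above) simp
  also have "\<dots> = (\<Sum>xs\<in>signed_dominoes n. (1 + fps_X) * ((1 + fps_X) * site_weight xs - 1))"
  proof (intro sum.cong refl)
    fix xs
    have "- int (bottoms xs) - 1 \<notin> sites xs" by (auto simp: sites_def)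
    then show "(1 + fps_X) * ((1 + fps_X) ^ card (?S xs) - 1) = (1 + fps_X) * ((1 + fps_X) * site_weight xs - 1)"
      by (simp add: site_weight_def)
  qed
  also have "\<dots> = (1 + fps_X) * ((1 + fps_X) * domino_poly n - of_nat (card (signed_dominoes n)))"
    by (simp add: domino_poly_def sum_subtractf flip: sum_distrib_left)
  also have "of_nat (card (signed_dominoes n)) = fps_const (domino_poly n $ 0)"
    by (simp add: domino_poly_nth_0 fps_of_nat)
  finally have B: "fps_X * (\<Sum>zs\<in>?B. site_weight zs) =
      (1 + fps_X) * ((1 + fps_X) * domino_poly n - fps_const (domino_poly n $ 0))" .
  have split: "signed_dominoes (Suc n) = top_ended (Suc n) \<union> ?B"
    by (auto simp: top_ended_def)
  have "(\<Sum>zs\<in>top_ended (Suc n) \<union> ?B. site_weight zs) =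
      (\<Sum>zs\<in>top_ended (Suc n). site_weight zs) + (\<Sum>zs\<in>?B. site_weight zs)"
  proof (rule sum.union_disjoint)
    show "top_ended (Suc n) \<inter> ?B = {}"
      by (auto simp: top_ended_def signed_dominoes_def)
  qed simp_all
  then have "domino_poly (Suc n) = top_ended_poly (Suc n) + (\<Sum>zs\<in>?B. site_weight zs)"
    unfolding domino_poly_def top_ended_poly_def split[symmetric] .
  then show ?thesis using B by (simp add: distrib_left)
qed

section \<open>Translating dominoes into signed lists\<close>

lemma order_isomorphic_213:
  "order_isomorphic ys [2, 1, 3] \<longleftrightarrow> (\<exists>a b c. ys = [a, b, c] \<and> b < a \<and> a < c)"
  by (auto simp: order_isomorphic_def length_Suc_conv numeral_eq_Suc All_less_Suc)
    (auto simp: less_Suc_eq)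

lemma order_isomorphic_132:
  "order_isomorphic ys [1, 3, 2] \<longleftrightarrow> (\<exists>a b c. ys = [a, b, c] \<and> a < c \<and> c < b)"
  by (auto simp: order_isomorphic_def length_Suc_conv numeral_eq_Suc All_less_Suc)
    (auto simp: less_Suc_eq)

lemma order_isomorphic_1324:
  "order_isomorphic ys [1, 3, 2, 4] \<longleftrightarrow> (\<exists>a b c d. ys = [a, c, b, d] \<and> a < b \<and> b < c \<and> c < d)"
  by (auto simp: order_isomorphic_def length_Suc_conv numeral_eq_Suc All_less_Suc)
    (auto simp: less_Suc_eq)

text \<open>Once 132 is excluded below the divider and 213 above it, an occurrence of 1324 must have its
  points 1 and 2 below and its points 3 and 4 above.\<close>

lemma admissible_iff_avoids:
  "admissible (map (\<lambda>v. int v - int r) \<sigma>) \<longleftrightarrow>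
     avoids \<sigma> [1, 3, 2, 4] \<and> avoids (filter (\<lambda>v. v \<ge> r) \<sigma>) [2, 1, 3] \<and>
     avoids (filter (\<lambda>v. v < r) \<sigma>) [1, 3, 2]" (is "_ \<longleftrightarrow> ?R")
proof -
  have A: "admissible (map (\<lambda>v. int v - int r) \<sigma>) \<longleftrightarrow>
      (\<forall>a b c. subseq [a, b, c] \<sigma> \<longrightarrow> \<not> (r \<le> b \<and> b < a \<and> a < c) \<and> \<not> (a < c \<and> c < b \<and> b < r)) \<and>
      (\<forall>a c b d. subseq [a, c, b, d] \<sigma> \<longrightarrow> \<not> (a < b \<and> b < r \<and> r \<le> c \<and> c < d))" (is "_ \<longleftrightarrow> ?A3 \<and> ?A4")
    unfolding admissible_def subseq_map_all3 subseq_map_all4 by simp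
  have R: "?R \<longleftrightarrow>
      (\<forall>a c b d. subseq [a, c, b, d] \<sigma> \<longrightarrow> \<not> (a < b \<and> b < c \<and> c < d)) \<and>
      (\<forall>a b c. subseq [a, b, c] \<sigma> \<longrightarrow> \<not> (r \<le> b \<and> b < a \<and> a < c)) \<and>
      (\<forall>a b c. subseq [a, b, c] \<sigma> \<longrightarrow> \<not> (a < c \<and> c < b \<and> b < r))" (is "_ \<longleftrightarrow> ?R4 \<and> ?R213 \<and> ?R132")
  proof -
    have subseq3_filter: "subseq [a, b, c] (filter P \<sigma>) \<longleftrightarrow> subseq [a, b, c] \<sigma> \<and> P a \<and> P b \<and> P c"
      for P and a b c :: nat
      by (simp add: subseq_filter_iff)
    have "avoids \<sigma> [1, 3, 2, 4] \<longleftrightarrow> ?R4"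
      unfolding avoids_def order_isomorphic_1324 by blast
    moreover have "avoids (filter (\<lambda>v. v \<ge> r) \<sigma>) [2, 1, 3] \<longleftrightarrow>
        (\<forall>a b c. subseq [a, b, c] \<sigma> \<longrightarrow> \<not> (r \<le> a \<and> r \<le> b \<and> r \<le> c \<and> b < a \<and> a < c))"
      unfolding avoids_def order_isomorphic_213 using subseq3_filter by metis
    moreover have "\<dots> \<longleftrightarrow> ?R213"
      by (meson order_less_imp_le order_trans)
    moreover have "avoids (filter (\<lambda>v. v < r) \<sigma>) [1, 3, 2] \<longleftrightarrow>
        (\<forall>a b c. subseq [a, b, c] \<sigma> \<longrightarrow> \<not> (a < r \<and> b < r \<and> c < r \<and> a < c \<and> c < b))"
      unfolding avoids_def order_isomorphic_132 using subseq3_filter by metis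
    moreover have "\<dots> \<longleftrightarrow> ?R132"
      by (meson order.strict_trans)
    ultimately show ?thesis by (simp only:)
  qed
  have "?R4 \<longleftrightarrow> ?A4" if "?A3"
  proof
    assume ?R4
    then show ?A4 by (meson order_less_le_trans)
  next
    assume A4: ?A4
    show ?R4
    proof (intro allI impI notI)
      fix a c b d assume s: "subseq [a, c, b, d] \<sigma>" and o: "a < b \<and> b < c \<and> c < d"
      have "subseq [a, c, b] [a, c, b, d]" "subseq [c, b, d] [a, c, b, d]" by simp_all
      then have "subseq [a, c, b] \<sigma>" "subseq [c, b, d] \<sigma>"
        using s subseq_order.order_trans by blast+
      then show False using \<open>?A3\<close> A4 s o by (meson not_le)
    qed
  qed
  then show ?thesis unfolding A R by blast
qed

lemma card_dominoes: "card (of_size domino_size dominoes n) = card (signed_dominoes n)"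
proof -
  let ?D = "of_size domino_size dominoes n"
  let ?g = "\<lambda>(\<sigma>, r). map (\<lambda>v. int v - int r) \<sigma>"
  let ?h = "\<lambda>xs. (map (\<lambda>x. nat (x + int (bottoms xs) + 1)) xs, bottoms xs + 1)"
  have fwd: "?g (\<sigma>, r) \<in> signed_dominoes n \<and> bottoms (?g (\<sigma>, r)) + 1 = r" if "(\<sigma>, r) \<in> ?D" for \<sigma> r
  proof -
    have \<sigma>: "set \<sigma> = {1..n}" "distinct \<sigma>" "length \<sigma> = n" "1 \<le> r" "r \<le> n + 1"
      and adm: "admissible (?g (\<sigma>, r))"
      using that by (auto simp: of_size_def dominoes_def domino_size_def admissible_iff_avoids
        dest: permutations_of_setD)
    have "set (?g (\<sigma>, r)) = {- int (r - 1)..<int (n + 1 - r)}"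
    proof -
      have "(\<lambda>v. int v - int r) ` {1..n} = {- int (r - 1)..<int (n + 1 - r)}"
      proof (intro equalityI subsetI)
        fix y assume "y \<in> {- int (r - 1)..<int (n + 1 - r)}"
        then show "y \<in> (\<lambda>v. int v - int r) ` {1..n}"
          using \<sigma>(4,5) by (intro image_eqI[of _ _ "nat (y + int r)"]) auto
      qed (use \<sigma>(4,5) in auto)
      then show ?thesis by (simp add: \<sigma>(1))
    qed
    moreover have "distinct (?g (\<sigma>, r))"
      using \<sigma>(2) by (simp add: distinct_map inj_on_def)
    ultimately have "normalized (?g (\<sigma>, r))" "bottoms (?g (\<sigma>, r)) = r - 1"
      using normalizedI by blast+
    then show ?thesis using adm \<sigma> by (simp add: signed_dominoes_def)
  qed
  have bwd: "?h xs \<in> ?D \<and> ?g (?h xs) = xs" if "xs \<in> signed_dominoes n" for xs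
  proof -
    have xs: "set xs = {- int (bottoms xs)..<int (tops xs)}" "distinct xs" "admissible xs" "length xs = n"
      using that by (auto simp: signed_dominoes_def normalized_def)
    have bt: "bottoms xs + tops xs = n" using bottoms_tops_length xs(4) by simp
    have "map (\<lambda>x. int (nat (x + int (bottoms xs) + 1)) - int (bottoms xs + 1)) xs = map id xs"
      by (rule map_cong) (auto simp: xs(1))
    then have inv: "?g (?h xs) = xs" by (simp add: o_def)
    have "(\<lambda>x. nat (x + int (bottoms xs) + 1)) ` {- int (bottoms xs)..<int (tops xs)} = {1..n}"
    proof (intro equalityI subsetI)
      fix y assume "y \<in> {1..n}"
      then show "y \<in> (\<lambda>x. nat (x + int (bottoms xs) + 1)) ` {- int (bottoms xs)..<int (tops xs)}"
        using bt by (intro image_eqI[of _ _ "int y - int (bottoms xs) - 1"]) auto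
    qed (use bt in auto)
    then have "set (fst (?h xs)) = {1..n}" by (simp add: xs(1))
    moreover have "distinct (fst (?h xs))"
      using xs(2) by (auto simp: distinct_map inj_on_def xs(1))
    ultimately have "fst (?h xs) \<in> permutations_of_set {1..n}"
      by (auto simp: permutations_of_set_def)
    moreover have "admissible (?g (?h xs))" using inv xs(3) by simp
    ultimately show ?thesis
      using inv xs(4) bt admissible_iff_avoids[of "bottoms xs + 1" "fst (?h xs)"]
      by (auto simp: of_size_def dominoes_def domino_size_def)
  qed
  have "bij_betw ?g ?D (signed_dominoes n)"
  proof (rule bij_betw_byWitness[where f' = ?h])
    show "\<forall>d\<in>?D. ?h (?g d) = d"
    proof
      fix d assume d: "d \<in> ?D"
      obtain \<sigma> r where dr: "d = (\<sigma>, r)" by (cases d)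
      have "bottoms (?g d) + 1 = r" using fwd d dr by blast
      moreover from this have "map (\<lambda>x. nat (x + int (bottoms (?g d)) + 1)) (?g d) = map id \<sigma>"
        unfolding dr prod.case map_map by (intro map_cong) auto
      ultimately show "?h (?g d) = d" by (simp add: dr)
    qed
    show "\<forall>xs\<in>signed_dominoes n. ?g (?h xs) = xs" using bwd by blast
    show "?g ` ?D \<subseteq> signed_dominoes n"
      by (rule image_subsetI) (metis fwd surj_pair)
    show "?h ` signed_dominoes n \<subseteq> ?D" using bwd by blast
  qed
  then show ?thesis by (rule bij_betw_same_card)
qed

section \<open>Power series defined by polynomial equations\<close>

text \<open>If the \<open>n\<close>-th coefficient of \<open>\<Phi> f\<close> depends only on the lower coefficients of \<open>f\<close>, iterating
  \<open>\<Phi>\<close> from any start fixes one more coefficient at each step.\<close>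

lemma fps_contraction_fixpoint:
  fixes \<Phi> :: "'a::zero fps \<Rightarrow> 'a fps"
  assumes contr: "\<And>f g n. (\<And>k. k < n \<Longrightarrow> f $ k = g $ k) \<Longrightarrow> \<Phi> f $ n = \<Phi> g $ n"
  obtains f where "\<Phi> f = f"
proof -
  define it where "it n = (\<Phi> ^^ n) 0" for n
  have step: "it (Suc n) $ k = it n $ k" if "k < n" for n k
    using that
  proof (induction n arbitrary: k)
    case (Suc n)
    have "\<Phi> (it (Suc n)) $ k = \<Phi> (it n) $ k"
      using Suc by (intro contr) auto
    then show ?case by (simp add: it_def)
  qed simp
  have stable: "it n $ k = it (Suc k) $ k" if "k < n" for n k
    using that
  proof (induction n)
    case (Suc n)
    then show ?case using step[of k n] by (cases "k = n") auto
  qed simp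
  define f where "f = Abs_fps (\<lambda>k. it (Suc k) $ k)"
  have "\<Phi> f $ n = f $ n" for n
  proof -
    have "\<Phi> f $ n = \<Phi> (it n) $ n"
      by (rule contr) (simp only: f_def fps_nth_Abs_fps, rule stable[symmetric])
    then show ?thesis by (simp add: f_def it_def)
  qed
  then have "\<Phi> f = f" by (simp add: fps_eq_iff)
  then show thesis by (rule that)
qed

lemma fps_mult_nth_cong:
  fixes f g :: "'a::semiring_0 fps"
  assumes "\<And>k. k \<le> n \<Longrightarrow> f $ k = f' $ k" "\<And>k. k \<le> n \<Longrightarrow> g $ k = g' $ k" "k \<le> n"
  shows "(f * g) $ k = (f' * g') $ k"
  using assms by (auto simp: fps_mult_nth intro!: sum.cong)

lemma fps_cubic_fixpoint:
  fixes a b c d :: "'a::comm_ring_1 fps"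
  obtains f where "f = a + fps_X * (b * f + c * f ^ 2 + d * f ^ 3)"
proof (rule fps_contraction_fixpoint[of "\<lambda>f. a + fps_X * (b * f + c * f ^ 2 + d * f ^ 3)"])
  fix f g :: "'a fps" and n
  assume eq: "\<And>k. k < n \<Longrightarrow> f $ k = g $ k"
  show "(a + fps_X * (b * f + c * f ^ 2 + d * f ^ 3)) $ n = (a + fps_X * (b * g + c * g ^ 2 + d * g ^ 3)) $ n"
  proof (cases n)
    case (Suc m)
    then have "f $ k = g $ k" if "k \<le> m" for k
      using eq that by simp
    then have "(b * f + c * f ^ 2 + d * f ^ 3) $ m = (b * g + c * g ^ 2 + d * g ^ 3) $ m"
      unfolding power2_eq_square power3_eq_cube fps_add_nth
      by (intro arg_cong2[where f = "(+)"] fps_mult_nth_cong[of m]) (auto intro!: fps_mult_nth_cong[of m])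
    then show ?thesis using Suc by simp
  qed simp
qed (metis that)

lemma fps_unit:
  fixes f :: "'a::comm_ring_1 fps"
  assumes "f $ 0 = 1"
  obtains g where "f * g = 1"
  using fps_right_inverse[of f 1] assms by auto

text \<open>The series \<open>z = t W\<close> with \<open>z (1 - z)\<^sup>2 = t\<close>. The equation for \<open>z\<close> itself is not contracting,
  while the one for \<open>W\<close>, namely \<open>W (1 - t W)\<^sup>2 = 1\<close>, is.\<close>

lemma tree_series_exists:
  obtains W :: "real fps" where "fps_X * W * (1 - fps_X * W) ^ 2 = fps_X"
proof -
  obtain W :: "real fps" where "W = 1 + fps_X * (0 * W + 2 * W ^ 2 + (- fps_X) * W ^ 3)"
    by (rule fps_cubic_fixpoint)
  then have "W - (1 + fps_X * (0 * W + 2 * W ^ 2 + (- fps_X) * W ^ 3)) = 0"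
    by (simp only: right_minus_eq)
  then have "W * (1 - fps_X * W) ^ 2 = 1"
    by algebra
  then have "fps_X * W * (1 - fps_X * W) ^ 2 = fps_X"
    by (simp add: mult.assoc)
  then show thesis by (rule that)
qed

section \<open>Solving the functional equation\<close>

text \<open>The equations determine the coefficients of \<open>t\<^sup>n\<close> in \<open>Y\<close>, and then in \<open>v D\<close>, from lower
  ones. Since \<open>v\<close> is not a zero divisor, this also determines \<open>D\<close>.\<close>

lemma functional_equation_unique:
  fixes D Y D' Y' :: "'a::idom fps fps"
  defines "u \<equiv> fps_const (1 + fps_X)" and "v \<equiv> fps_const fps_X"
  assumes "Y = 1 + fps_X * (D * Y)" "Y' = 1 + fps_X * (D' * Y')"
    and "v * D = v * Y + fps_X * (u * (u * D - Abs_fps (\<lambda>n. fps_const (D $ n $ 0))))"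
    and "v * D' = v * Y' + fps_X * (u * (u * D' - Abs_fps (\<lambda>n. fps_const (D' $ n $ 0))))"
  shows "D = D'"
proof -
  have "D $ n = D' $ n \<and> Y $ n = Y' $ n" for n
  proof (induction n rule: less_induct)
    case (less n)
    have Y: "Y $ n = Y' $ n"
    proof (cases n)
      case 0
      then show ?thesis by (subst assms(3), subst assms(4)) simp
    next
      case (Suc m)
      then have "(D * Y) $ m = (D' * Y') $ m"
        using less by (intro fps_mult_nth_cong[of m]) auto
      then show ?thesis by (subst assms(3), subst assms(4)) (simp add: Suc)
    qed
    have "(v * D) $ n = (v * D') $ n"
    proof (cases n)
      case 0
      then show ?thesis using Y by (subst assms(5), subst assms(6)) (simp add: v_def)
    next
      case (Suc m)
      then show ?thesis using Y less[of m]
        by (subst assms(5), subst assms(6)) (simp add: v_def u_def)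
    qed
    then show ?case using Y by (simp add: v_def)
  qed
  then show ?thesis by (simp add: fps_eq_iff)
qed

text \<open>Series in \<open>t\<close>, regarded as series in \<open>t\<close> and \<open>v\<close> that do not involve \<open>v\<close>.\<close>

definition fps_lift :: "'a::zero fps \<Rightarrow> 'a fps fps" where
  "fps_lift f = Abs_fps (\<lambda>n. fps_const (f $ n))"

lemma fps_lift_nth [simp]: "fps_lift f $ n = fps_const (f $ n)"
  by (simp add: fps_lift_def)

lemma fps_lift_hom [simp]:
  fixes f g :: "'a::comm_ring_1 fps"
  shows "fps_lift (f + g) = fps_lift f + fps_lift g"
    "fps_lift (f - g) = fps_lift f - fps_lift g"
    "fps_lift (f * g) = fps_lift f * fps_lift g"
    "fps_lift (1 :: 'a fps) = 1"
    "fps_lift (fps_X :: 'a fps) = fps_X"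
  by (auto simp: fps_eq_iff fps_mult_nth fps_X_def fps_sum_nth)

lemma fps_lift_power [simp]: "fps_lift (f ^ n) = fps_lift (f :: 'a::comm_ring_1 fps) ^ n"
  by (induction n) auto

text \<open>Since \<open>t D = 1 - 1/Y\<close>, clearing denominators turns the functional equation into
  \[ t v Y^2 - (K + t^2 u f) Y + K = 0, \qquad K = v - t u^2. \]
  For \<open>f = (1 - 2z) / (1 - z)\<^sup>4\<close> and \<open>t = z(1 - z)\<^sup>2\<close> its discriminant is \<open>L\<^sup>2 (A\<^sup>2 - 4c)\<close> with
  \<open>L = (1 - z)v - z\<close>, \<open>A = 1 - 3z + 3z\<^sup>2 - z(1 - z)v\<close> and \<open>c = z\<^sup>3(1 - z)v\<close>. If \<open>A j = 1 + c j\<^sup>2\<close>, then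
  \<open>A - 2 c j\<close> is a square root of \<open>A\<^sup>2 - 4c\<close>, and the root of the quadratic that is a power series
  simplifies to \<open>Y = (1 + z\<^sup>2 L j) / (1 - z)\<close>. By uniqueness it is enough to check this candidate.\<close>

lemma functional_equation_solution:
  fixes D Y :: "real fps fps" and W Z :: "real fps"
  defines "u \<equiv> fps_const (1 + fps_X)" and "v \<equiv> fps_const fps_X"
  defines "f \<equiv> Abs_fps (\<lambda>n. D $ n $ 0)"
  assumes Y: "Y = 1 + fps_X * (D * Y)"
    and D: "v * D = v * Y + fps_X * (u * (u * D - fps_lift f))"
    and W: "Z = fps_X * W" and Z: "Z * (1 - Z) ^ 2 = fps_X"
  shows "f * (1 - Z) ^ 4 = 1 - 2 * Z"
proof -
  have "(1 - Z) $ 0 = 1" by (simp add: W)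
  then obtain q where q: "(1 - Z) * q = 1" using fps_unit by blast
  define z w r where "z = fps_lift Z" and "w = fps_lift W" and "r = fps_lift q"
  have z: "z * (1 - z) ^ 2 = fps_X" "z = fps_X * w" "(1 - z) * r = 1"
    using arg_cong[OF Z, of fps_lift] arg_cong[OF W, of fps_lift] arg_cong[OF q, of fps_lift]
    by (simp_all add: z_def w_def r_def)
  have u: "u = 1 + v" by (simp add: u_def v_def flip: fps_const_add)
  \<comment> \<open>With \<open>z = t w\<close>, the equation \<open>A j = 1 + c j\<^sup>2\<close> is contracting in powers of \<open>t\<close>.\<close>
  obtain j where "j = 1 + fps_X * ((w * (3 - 3 * z + (1 - z) * v)) * j
      + (w * z ^ 2 * (1 - z) * v) * j ^ 2 + 0 * j ^ 3)"
    by (rule fps_cubic_fixpoint)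
  then have "j - (1 + fps_X * ((w * (3 - 3 * z + (1 - z) * v)) * j
      + (w * z ^ 2 * (1 - z) * v) * j ^ 2 + 0 * j ^ 3)) = 0"
    by (simp only: right_minus_eq)
  then have j: "(1 - 3 * z + 3 * z ^ 2 - z * (1 - z) * v) * j = 1 + z ^ 3 * (1 - z) * v * j ^ 2"
    using z(2) by algebra
  define L where "L = (1 - z) * v - z"
  define M N where "M = 1 + z ^ 2 * L * j" and "N = 1 + z * L * j"
  have "M $ 0 = 1" by (simp add: M_def z(2) power2_eq_square mult.assoc)
  then obtain B where B: "M * B = 1" using fps_unit by blast
  have key: "v * (N - (1 - z) * M ^ 2) = z * u * (u * (1 - z) ^ 2 * N - (1 - 2 * z) * M)"
  proof -
    have "v * (N - (1 - z) * M ^ 2) - z * u * (u * (1 - z) ^ 2 * N - (1 - 2 * z) * M)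
        = z * L ^ 2 * ((1 - 3 * z + 3 * z ^ 2 - z * (1 - z) * v) * j - (1 + z ^ 3 * (1 - z) * v * j ^ 2))"
      unfolding M_def N_def L_def u by algebra
    then show ?thesis unfolding j by simp
  qed
  \<comment> \<open>\<open>D'\<close> is \<open>(1 - 1/Y') / t\<close>, where \<open>Y' - 1 = z N / (1 - z)\<close>.\<close>
  define D' Y' where "D' = r ^ 2 * N * B" and "Y' = r * M"
  have Y': "Y' = 1 + fps_X * (D' * Y')"
  proof -
    have "fps_X * (D' * Y') = z * r * ((1 - z) * r) ^ 2 * (M * B) * N"
      unfolding D'_def Y'_def z(1)[symmetric] by algebra
    also have "\<dots> = z * r * N" by (simp add: z(3) B)
    finally have "1 + fps_X * (D' * Y') = 1 + z * r * N" by simp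
    also have "\<dots> = (1 - z) * r + z * r * N" by (simp add: z(3))
    also have "\<dots> = Y'" unfolding N_def Y'_def M_def by algebra
    finally show ?thesis by simp
  qed
  have D'1: "v * D' = v * Y' + fps_X * (u * (u * D' - (1 - 2 * z) * r ^ 4))"
  proof -
    have "v * D' - v * Y' * ((1 - z) * r * (M * B)) = r ^ 2 * B * (v * (N - (1 - z) * M ^ 2))"
      unfolding D'_def Y'_def by algebra
    also have "\<dots> = r ^ 2 * B * (z * u * (u * (1 - z) ^ 2 * N - (1 - 2 * z) * M))"
      by (simp only: key)
    also have "\<dots> = u * (u * z * (1 - z) ^ 2 * D' - (1 - 2 * z) * z * r ^ 2 * (M * B))"
      unfolding D'_def by algebra
    also have "\<dots> = u * (u * z * (1 - z) ^ 2 * D' - (1 - 2 * z) * z * r ^ 2 * ((1 - z) * r) ^ 2)"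
      by (simp add: z(3) B)
    also have "\<dots> = fps_X * (u * (u * D' - (1 - 2 * z) * r ^ 4))"
      unfolding z(1)[symmetric] by algebra
    finally show ?thesis by (simp add: z(3) B diff_eq_eq add.commute)
  qed
  define g where "g = (1 - 2 * Z) * q ^ 4"
  have "fps_lift (2 :: real fps) = 2"
    using fps_lift_hom(1)[of "1 :: real fps" 1] by simp
  then have g: "fps_lift g = (1 - 2 * z) * r ^ 4"
    by (simp add: g_def z_def r_def)
  \<comment> \<open>At \<open>v = 0\<close> the equation \<open>D'1\<close> reads \<open>0 = t (D' - g)\<close>, so the guessed value of \<open>D(t,1)\<close>
    is the one that the candidate has.\<close>
  have "D' $ n $ 0 = g $ n" for n
    using arg_cong[OF D'1, of "\<lambda>h. h $ Suc n $ 0"]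
    by (simp add: v_def u_def flip: g)
  then have "fps_lift g = Abs_fps (\<lambda>n. fps_const (D' $ n $ 0))"
    by (simp add: fps_eq_iff)
  then have lift_g: "Abs_fps (\<lambda>n. fps_const (D' $ n $ 0)) = (1 - 2 * z) * r ^ 4"
    by (simp add: g)
  have "D = D'"
  proof (rule functional_equation_unique[OF Y Y'])
    show "fps_const fps_X * D = fps_const fps_X * Y + fps_X * (fps_const (1 + fps_X) *
        (fps_const (1 + fps_X) * D - Abs_fps (\<lambda>n. fps_const (D $ n $ 0))))"
      using D by (simp add: fps_lift_def u_def v_def f_def)
    show "fps_const fps_X * D' = fps_const fps_X * Y' + fps_X * (fps_const (1 + fps_X) *
        (fps_const (1 + fps_X) * D' - Abs_fps (\<lambda>n. fps_const (D' $ n $ 0))))"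
      using D'1 by (simp only: u_def v_def lift_g)
  qed
  then have "f = g"
    using \<open>\<And>n. D' $ n $ 0 = g $ n\<close> by (simp add: f_def fps_eq_iff)
  moreover have "g * (1 - Z) ^ 4 = (1 - 2 * Z) * ((1 - Z) * q) ^ 4"
    unfolding g_def by algebra
  ultimately show ?thesis using q by simp
qed

section \<open>Coefficients and growth\<close>

text \<open>Write \<open>\<theta>\<close> for the operator \<open>t d/dt\<close>. Implicit differentiation expresses \<open>\<theta> f\<close> and \<open>\<theta>\<^sup>2 f\<close>
  (\<open>g\<close> and \<open>h\<close> in the proof) as rational functions of \<open>Z\<close>, which reduces the linear differential equation
  \[ (4 \theta^2 + 14 \theta + 12) f - 12 = t (27 \theta^2 + 81 \theta + 60) f \]
  to a polynomial identity in \<open>Z\<close>. On coefficients \<open>\<theta>\<close> multiplies by \<open>n\<close>.\<close>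

lemma coefficient_recurrence:
  fixes f Z :: "real fps"
  assumes f: "f * (1 - Z) ^ 4 = 1 - 2 * Z" and Z: "Z * (1 - Z) ^ 2 = fps_X" and Z0: "Z $ 0 = 0"
  shows "2 * (real n + 3) * (2 * real n + 5) * f $ Suc n = 3 * (3 * real n + 4) * (3 * real n + 5) * f $ n"
    and "f $ 0 = 1"
proof -
  have nz: "1 - Z \<noteq> 0" "1 - 3 * Z \<noteq> 0"
    using Z0 by (auto dest!: arg_cong[where f = "\<lambda>h. h $ 0"])
  define Z' f' where "Z' = fps_deriv Z" and "f' = fps_deriv f"
  have Z': "Z' * ((1 - Z) * (1 - 3 * Z)) = 1"
    using arg_cong[OF Z, of fps_deriv]
    by (simp add: Z'_def[symmetric] fps_deriv_power flip: numeral_fps_const) algebra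
  have "f' * (1 - Z) ^ 4 - 4 * f * (1 - Z) ^ 3 * Z' = - 2 * Z'"
    using arg_cong[OF f, of fps_deriv]
    by (simp add: Z'_def[symmetric] f'_def[symmetric] fps_deriv_power algebra_simps flip: numeral_fps_const)
  then have df: "f' * (1 - Z) ^ 4 = (4 * f * (1 - Z) ^ 3 - 2) * Z'"
    by (simp add: algebra_simps)
  have "((1 - Z) * (1 - 3 * Z)) * (f' * (1 - Z) ^ 6)
      = (1 - Z) ^ 3 * (1 - 3 * Z) * ((4 * f * (1 - Z) ^ 3 - 2) * Z')"
    unfolding df[symmetric] by algebra
  also have "\<dots> = (4 * (f * (1 - Z) ^ 4) - 2 * (1 - Z)) * (1 - Z) * (Z' * ((1 - Z) * (1 - 3 * Z)))"
    by algebra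
  also have "\<dots> = ((1 - Z) * (1 - 3 * Z)) * 2"
    unfolding f Z' by algebra
  finally have f': "f' * (1 - Z) ^ 6 = 2" using nz by simp
  define g g' h where "g = fps_X * f'" and "g' = fps_deriv g" and "h = fps_X * g'"
  have g: "g * (1 - Z) ^ 4 = 2 * Z"
  proof -
    have "g * (1 - Z) ^ 4 = Z * (f' * (1 - Z) ^ 6)"
      unfolding g_def Z[symmetric] by algebra
    then show ?thesis by (simp add: f')
  qed
  have "g' * (1 - Z) ^ 4 - 4 * g * (1 - Z) ^ 3 * Z' = 2 * Z'"
    using arg_cong[OF g, of fps_deriv]
    by (simp add: Z'_def[symmetric] g'_def[symmetric] fps_deriv_power algebra_simps flip: numeral_fps_const)
  then have dg: "g' * (1 - Z) ^ 4 = (4 * g * (1 - Z) ^ 3 + 2) * Z'"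
    by (simp add: algebra_simps)
  have "h * (1 - Z) ^ 4 * (1 - 3 * Z)
      = Z * (1 - Z) ^ 2 * (1 - 3 * Z) * ((4 * g * (1 - Z) ^ 3 + 2) * Z')"
    unfolding h_def Z[symmetric] dg[symmetric] by algebra
  also have "\<dots> = Z * (4 * (g * (1 - Z) ^ 4) + 2 * (1 - Z)) * (Z' * ((1 - Z) * (1 - 3 * Z)))"
    by algebra
  also have "\<dots> = 2 * Z * (1 + 3 * Z)"
    unfolding g Z' by algebra
  finally have h: "h * (1 - Z) ^ 4 * (1 - 3 * Z) = 2 * Z * (1 + 3 * Z)" .
  have "((1 - Z) ^ 4 * (1 - 3 * Z)) * (4 * h + 14 * g + 12 * f - 12) =
        ((1 - Z) ^ 4 * (1 - 3 * Z)) * (fps_X * (27 * h + 81 * g + 60 * f))"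
  proof -
    have "((1 - Z) ^ 4 * (1 - 3 * Z)) * (a * h + b * g + c * f)
        = a * (h * (1 - Z) ^ 4 * (1 - 3 * Z)) + (1 - 3 * Z) * (b * (g * (1 - Z) ^ 4) + c * (f * (1 - Z) ^ 4))"
      for a b c by algebra
    then have eq: "((1 - Z) ^ 4 * (1 - 3 * Z)) * (a * h + b * g + c * f)
        = a * (2 * Z * (1 + 3 * Z)) + (1 - 3 * Z) * (b * (2 * Z) + c * (1 - 2 * Z))" for a b c
      unfolding f g h .
    have "((1 - Z) ^ 4 * (1 - 3 * Z)) * (4 * h + 14 * g + 12 * f - 12)
        = ((1 - Z) ^ 4 * (1 - 3 * Z)) * (4 * h + 14 * g + 12 * f) - 12 * ((1 - Z) ^ 4 * (1 - 3 * Z))"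
      by algebra
    also have "\<dots> = Z * (1 - Z) ^ 2
        * (27 * (2 * Z * (1 + 3 * Z)) + (1 - 3 * Z) * (81 * (2 * Z) + 60 * (1 - 2 * Z)))"
      unfolding eq by algebra
    also have "\<dots> = ((1 - Z) ^ 4 * (1 - 3 * Z)) * (fps_X * (27 * h + 81 * g + 60 * f))"
      unfolding eq[symmetric] Z[symmetric] by algebra
    finally show ?thesis .
  qed
  then have ode: "4 * h + 14 * g + 12 * f - 12 = fps_X * (27 * h + 81 * g + 60 * f)"
    using nz by simp
  have nth: "g $ n = real n * f $ n" "h $ n = real n ^ 2 * f $ n" for n
    by (cases n; simp add: g_def h_def f'_def g'_def power2_eq_square algebra_simps)+
  have num: "(numeral k * s) $ n = numeral k * (s $ n)" "numeral k $ Suc n = (0 :: real)"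
    for k and s :: "real fps" and n
    by (simp_all add: numeral_fps_const)
  have "4 * (real (Suc n) ^ 2 * f $ Suc n) + 14 * (real (Suc n) * f $ Suc n) + 12 * f $ Suc n
      = 27 * (real n ^ 2 * f $ n) + 81 * (real n * f $ n) + 60 * f $ n"
    using arg_cong[OF ode, of "\<lambda>s. s $ Suc n"] by (simp add: num nth)
  then show "2 * (real n + 3) * (2 * real n + 5) * f $ Suc n = 3 * (3 * real n + 4) * (3 * real n + 5) * f $ n"
    by (simp add: power2_eq_square algebra_simps)
  show "f $ 0 = 1"
    using arg_cong[OF f, of "\<lambda>s. s $ 0"] Z0 by (simp add: fps_power_zeroth)
qed

lemma solve_for_successor:
  fixes a :: "nat \<Rightarrow> real"
  assumes "2 * (real n + 3) * (2 * real n + 5) * a (Suc n) = 3 * (3 * real n + 4) * (3 * real n + 5) * a n"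
  shows "a (Suc n) = 3 * (3 * real n + 4) * (3 * real n + 5) / (2 * (real n + 3) * (2 * real n + 5)) * a n"
proof -
  have "0 < 2 * (real n + 3) * (2 * real n + 5)" by simp
  then show ?thesis using assms by (metis less_irrefl nonzero_mult_div_cancel_left times_divide_eq_left)
qed

lemma closed_form_of_recurrence:
  fixes a :: "nat \<Rightarrow> real"
  assumes "a 0 = 1"
    and "\<And>n. 2 * (real n + 3) * (2 * real n + 5) * a (Suc n) = 3 * (3 * real n + 4) * (3 * real n + 5) * a n"
  shows "a n = 2 * fact (3 * n + 3) / (fact (n + 2) * fact (2 * n + 3))"
proof (induction n)
  case 0
  then show ?case using assms(1) by (simp add: fact_numeral)
next
  case (Suc n)
  define x y z where "x = (fact (3 * n + 3) :: real)" and "y = (fact (n + 2) :: real)"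
    and "z = (fact (2 * n + 3) :: real)"
  have nz: "y \<noteq> 0" "z \<noteq> 0" by (simp_all add: y_def z_def)
  have F: "fact (3 * Suc n + 3) = 3 * (real n + 2) * (3 * real n + 5) * (3 * real n + 4) * x"
    "fact (Suc n + 2) = (real n + 3) * y"
    "fact (2 * Suc n + 3) = (2 * real n + 5) * (2 * (real n + 2)) * z"
    by (simp_all add: numeral_eq_Suc algebra_simps x_def y_def z_def)
  have "a (Suc n) = 3 * (3 * real n + 4) * (3 * real n + 5) / (2 * (real n + 3) * (2 * real n + 5))
      * (2 * x / (y * z))"
    using solve_for_successor[OF assms(2)[of n]] Suc by (simp add: x_def y_def z_def)
  also have "\<dots> = 2 * (3 * (real n + 2) * (3 * real n + 5) * (3 * real n + 4) * x) /
      (((real n + 3) * y) * ((2 * real n + 5) * (2 * (real n + 2)) * z))"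
    using nz by (simp add: frac_eq_eq add_nonneg_eq_0_iff) (simp add: algebra_simps)
  finally show ?case unfolding F .
qed
text \<open>The ratio of consecutive terms is \<open>27/4 (1 - 5/(2n) + \<dots>)\<close>, so \<open>a n\<close> is \<open>(27/4)\<^sup>n\<close> up to a
  polynomial factor; the cube leaves room for a short induction.\<close>

lemma growth_of_recurrence:
  fixes a :: "nat \<Rightarrow> real"
  assumes "a 0 = 1"
    and rec: "\<And>n. 2 * (real n + 3) * (2 * real n + 5) * a (Suc n) = 3 * (3 * real n + 4) * (3 * real n + 5) * a n"
  shows "(\<lambda>n. root n (a n)) \<longlonglongrightarrow> 27 / 4"
proof -
  have step: "a (Suc n) = 3 * (3 * real n + 4) * (3 * real n + 5) / (2 * (real n + 3) * (2 * real n + 5)) * a n" for n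
    using rec[of n] by (rule solve_for_successor)
  have bounds: "(27 / 4) ^ n / (real n + 1) ^ 3 \<le> a n \<and> a n \<le> (27 / 4) ^ n" for n
  proof (induction n)
    case (Suc n)
    let ?q = "3 * (3 * real n + 4) * (3 * real n + 5) / (2 * (real n + 3) * (2 * real n + 5))"
    have up: "?q \<le> 27 / 4"
      by (simp add: divide_simps add_nonneg_pos) (simp add: algebra_simps)
    have lo: "27 / 4 * ((real n + 1) ^ 3 / (real n + 2) ^ 3) \<le> ?q"
      by (simp add: divide_simps) (simp add: algebra_simps power3_eq_cube)
    have "(27 / 4) ^ Suc n / (real (Suc n) + 1) ^ 3 =
        27 / 4 * ((real n + 1) ^ 3 / (real n + 2) ^ 3) * ((27 / 4) ^ n / (real n + 1) ^ 3)"
      by (simp add: add.commute)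
    also have "\<dots> \<le> ?q * a n"
      using lo Suc by (intro mult_mono) auto
    finally have lower: "(27 / 4) ^ Suc n / (real (Suc n) + 1) ^ 3 \<le> a (Suc n)" by (simp add: step)
    have "0 \<le> (27 / 4) ^ n / (real n + 1) ^ 3" by simp
    then have "0 \<le> a n"
      using Suc by linarith
    then have "?q * a n \<le> 27 / 4 * (27 / 4) ^ n"
      using up Suc by (intro mult_mono) auto
    then have "a (Suc n) \<le> (27 / 4) ^ Suc n" by (simp add: step)
    with lower show ?case by blast
  qed (simp add: assms(1))
  have "(\<lambda>n. (27 / 4) / (root n (real n + 1)) ^ 3) \<longlonglongrightarrow> 27 / 4"
  proof -
    have "(\<lambda>n. root n (real n + 1)) \<longlonglongrightarrow> 1"
    proof (rule Lim_transform_eventually)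
      show "(\<lambda>n. (real n + 1) powr (1 / real n)) \<longlonglongrightarrow> 1" by real_asymp
      show "\<forall>\<^sub>F n in sequentially. (real n + 1) powr (1 / real n) = root n (real n + 1)"
        using eventually_gt_at_top[of 0] by eventually_elim (simp add: root_powr_inverse)
    qed
    then have "(\<lambda>n. (27 / 4) / (root n (real n + 1)) ^ 3) \<longlonglongrightarrow> 27 / 4 / 1 ^ 3"
      by (intro tendsto_intros) auto
    then show ?thesis by simp
  qed
  then show ?thesis
  proof (rule tendsto_sandwich[rotated 2])
    show "(\<lambda>n. 27 / 4) \<longlonglongrightarrow> (27 / 4 :: real)" by simp
    show "\<forall>\<^sub>F n in sequentially. 27 / 4 / (root n (real n + 1)) ^ 3 \<le> root n (a n)"
      using eventually_gt_at_top[of 0]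
    proof eventually_elim
      case (elim n)
      have "27 / 4 / (root n (real n + 1)) ^ 3 = root n ((27 / 4) ^ n / (real n + 1) ^ 3)"
        using elim real_root_power_cancel[of n "27 / 4"]
        by (simp only: real_root_divide[of n "(27 / 4) ^ n"] real_root_power)
      also have "\<dots> \<le> root n (a n)" using bounds elim by (intro real_root_le_mono) auto
      finally show ?case .
    qed
    show "\<forall>\<^sub>F n in sequentially. root n (a n) \<le> 27 / 4"
      using eventually_gt_at_top[of 0]
    proof eventually_elim
      case (elim n)
      have "root n (a n) \<le> root n ((27 / 4) ^ n)" using bounds elim by (intro real_root_le_mono) auto
      then show ?case using elim by (simp add: real_root_power_cancel)
    qed
  qed
qed

section \<open>The number of dominoes\<close>

lemma counting_series_recurrence:
  defines "a \<equiv> \<lambda>n. real (card (of_size domino_size dominoes n))"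
  shows "a 0 = 1"
    and "2 * (real n + 3) * (2 * real n + 5) * a (Suc n) = 3 * (3 * real n + 4) * (3 * real n + 5) * a n"
proof -
  define D Y where "D = Abs_fps domino_poly" and "Y = Abs_fps top_ended_poly"
  define f where "f = Abs_fps (\<lambda>n. D $ n $ 0)"
  have Y: "Y = 1 + fps_X * (D * Y)"
  proof (rule fps_ext)
    have conv: "(D * Y) $ n = top_ended_poly (Suc n)" for n
      by (simp add: D_def Y_def top_ended_poly_Suc fps_mult_nth atLeast0AtMost)
    show "Y $ n = (1 + fps_X * (D * Y)) $ n" for n
      by (cases n) (simp_all add: conv, simp_all add: Y_def polys_0)
  qed
  have D: "fps_const fps_X * D = fps_const fps_X * Y
      + fps_X * (fps_const (1 + fps_X) * (fps_const (1 + fps_X) * D - fps_lift f))"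
    (is "?l = ?r")
  proof (rule fps_ext)
    show "?l $ n = ?r $ n" for n
      by (cases n) (simp_all add: D_def Y_def f_def polys_0 domino_poly_Suc)
  qed
  obtain W :: "real fps" where W: "fps_X * W * (1 - fps_X * W) ^ 2 = fps_X"
    by (rule tree_series_exists)
  have f: "f * (1 - fps_X * W) ^ 4 = 1 - 2 * (fps_X * W)"
    unfolding f_def using Y D W
    by (intro functional_equation_solution[where W = W]) (simp_all add: f_def)
  have a: "a n = f $ n" for n
    by (simp add: a_def f_def D_def domino_poly_nth_0 card_dominoes)
  show "a 0 = 1"
    unfolding a using coefficient_recurrence(2)[OF f W] by simp
  show "2 * (real n + 3) * (2 * real n + 5) * a (Suc n) = 3 * (3 * real n + 4) * (3 * real n + 5) * a n"
    unfolding a using coefficient_recurrence(1)[OF f W] by simp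
qed

theorem theorem3p1:
  shows "(\<forall>n::nat. real (card (of_size domino_size dominoes n)) =
            2 * fact (3 * n + 3) / (fact (n + 2) * fact (2 * n + 3))) \<and>
         growth_rate domino_size dominoes = ereal (27 / 4)"
proof
  show "\<forall>n::nat. real (card (of_size domino_size dominoes n)) =
            2 * fact (3 * n + 3) / (fact (n + 2) * fact (2 * n + 3))"
    by (intro allI closed_form_of_recurrence[of "\<lambda>n. real (card (of_size domino_size dominoes n))"]
        counting_series_recurrence)
  have "(\<lambda>n. root n (real (card (of_size domino_size dominoes n)))) \<longlonglongrightarrow> 27 / 4"
    by (intro growth_of_recurrence counting_series_recurrence)
  then have "(\<lambda>n. ereal (root n (real (card (of_size domino_size dominoes n))))) \<longlonglongrightarrow> ereal (27 / 4)"
    by (simp only: lim_ereal)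
  then show "growth_rate domino_size dominoes = ereal (27 / 4)"
    unfolding growth_rate_def by (intro lim_imp_Limsup) simp_all
qed

end
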